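(* Let $k\ge 1$ and $m_1,\dots,m_k\geq 1$, and suppose that $E_1(R,S),\dots,E_k(R,S)$ are formulas in the signature of $\mathsf{SO}+\mathsf{GC}$, where $E_i(R,S)$ has exactly two free variables $R,S$, both $m_i$-ary concept variables, such that for each $i$ the theory $\mathsf{SO}+\mathsf{GC}$ proves that $E_i$ is an equivalence relation on $m_i$-ary concepts. Then the theory $\Sigma^1_1\text{-}[E_1,\dots,E_k]\mathsf{A}+\mathsf{SO}+\mathsf{GC}$ is consistent.
   Context: **Language of pure second-order logic.** Many-sorted: one sort of objects and, for each $n\ge 1$, a sort of $n$-ary concepts. The signature of $\mathsf{SO}$ consists of the predication relations $R(a_1,\dots,a_n)$ and, for all $m,n>0$, the function symbols $(R,a_1,\dots,a_n)\mapsto R[a_1,\dots,a_n]$ taking an $(n+m)$-ary concept and $n$ objects to the $m$-ary concept $\{(y_1,\dots,y_m):R(a_1,\dots,a_n,y_1,\dots,y_m)\}$. Concept quantifiers are called second-order; semantics is Henkin semantics (ordinary many-sorted first-order logic). Identity of concepts is extensional. **$\mathsf{SO}$** consists of the extensionality axioms and the Full Comprehension Schema in its signature: $\exists R\,\forall\overline a\,(R\overline a\leftrightarrow\varphi(\overline a))$ for every formula $\varphi(\overline x)$, possibly with object and concept parameters, with $R$ an $n$-ary concept variable ($n\geq 1$) not free in $\varphi$. **$\mathsf{GC}$**: for a theory $T$, $T+\mathsf{GC}$ expands the signature by a binary relation symbol $<$ on objects, adds axioms saying that $<$ is a linear order of the objects, and adds the schema $[\exists x\,\varphi(x)]\to[\exists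 x\,(\varphi(x)\wedge\forall y<x\,\neg\varphi(y))]$ for all formulas $\varphi(x)$ ($x$ an object variable) of the expanded signature, possibly with parameters. The comprehension and choice schemata of $T$ are allowed to use $<$; in particular, in $\mathsf{SO}+\mathsf{GC}$ the Full Comprehension Schema covers all formulas of the signature of $\mathsf{SO}$ together with $<$. **Abstraction principles.** For a formula $E(R,S)$ with exactly two free $n$-ary concept variables, $A[E]$ is the axiom $\forall R,S\,[\partial_E(R)=\partial_E(S)\leftrightarrow E(R,S)]$, in a signature expanded by a new function symbol $\partial_E$ from $n$-ary concepts to objects. **$\Sigma^1_1\text{-}[E_1,\dots,E_k]\mathsf{A}$** consists of $A[E_1]\wedge\dots\wedge A[E_k]$ together with the following two schemata in the signature containing all of $\partial_{E_1},\dots,\partial_{E_k}$. *First-Order Comprehension Schema*: $\exists R\,\forall\overline a\,(R\overline a\leftrightarrow\varphi(\overline a))$ for all $\varphi$ without second-order quantifiers, possibly with parameters, $R$ not free in $\varphi$. *$\Sigma^1_1$-Choice Schema*: $[\forall\overline x\,\exists R'\,\varphi(\overline x,R')]\to\exists R\,\forall\overline x\,\varphi(\overline x,R[\overline x])$ for every $\Sigma^1_1$-formula $\varphi$ (a block of existential concept quantifiers followed by a formula with no second-order quantifiers), possibly with parameters, where $\overline x$ is an $n$-tuple of object variables, $R'$ is $m$-ary, $R$ is $(n+m)$-ary and not free in $\varphi$ ($n,m\ge1$). The combined theory $\Sigma^1_1\text{-}[E_1,\dots,E_k]\mathsf{A}+\mathsf{SO}+\mathsf{GC}$ thus has full comprehension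 for formulas in the signature of $\mathsf{SO}+\mathsf{GC}$, but only the First-Order Comprehension and $\Sigma^1_1$-Choice Schemata (and the $\mathsf{GC}$ schema) for formulas in the full signature including $\partial_{E_1},\dots,\partial_{E_k}$ and $<$. *)

theory Defs
  imports Main
begin

section \<open>Many-sorted second-order syntax\<close>

text \<open>\<open>Ob\<close> is the sort of objects and \<open>Cn n\<close>, for \<open>n \<ge> 1\<close>, the sort of \<open>n\<close>-ary concepts;
  \<open>Cn 0\<close> is excluded from all well-formed expressions. A variable carries its sort, so each sort
  has its own countable supply of variables.\<close>

datatype sort = Ob | Cn nat

type_synonym var = "sort \<times> nat"

text \<open>\<open>Sec t [a\<^sub>1, \<dots>, a\<^sub>n]\<close> is the section \<open>t[a\<^sub>1, \<dots>, a\<^sub>n]\<close>, and \<open>Abstr i t\<close> applies the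
  \<open>i\<close>-th abstraction operator to \<open>t\<close>.\<close>

datatype tm = Var var | Sec tm "tm list" | Abstr nat tm

datatype fm =
    Fls
  | Eq tm tm
  | Less tm tm
  | Pred tm "tm list"
  | Imp fm fm
  | Forall var fm

abbreviation Neg :: "fm \<Rightarrow> fm" where
  "Neg \<phi> \<equiv> Imp \<phi> Fls"

abbreviation And :: "fm \<Rightarrow> fm \<Rightarrow> fm" where
  "And \<phi> \<psi> \<equiv> Neg (Imp \<phi> (Neg \<psi>))"

abbreviation Or :: "fm \<Rightarrow> fm \<Rightarrow> fm" where
  "Or \<phi> \<psi> \<equiv> Imp (Neg \<phi>) \<psi>"

abbreviation Iff :: "fm \<Rightarrow> fm \<Rightarrow> fm" where
  "Iff \<phi> \<psi> \<equiv> And (Imp \<phi> \<psi>) (Imp \<psi> \<phi>)"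

abbreviation Exists :: "var \<Rightarrow> fm \<Rightarrow> fm" where
  "Exists x \<phi> \<equiv> Neg (Forall x (Neg \<phi>))"

abbreviation Foralls :: "var list \<Rightarrow> fm \<Rightarrow> fm" where
  "Foralls xs \<phi> \<equiv> foldr Forall xs \<phi>"

text \<open>A signature is the list of the arities of the arguments of the abstraction operators; the
  predication relations, the section symbols and \<open><\<close> are always present. In particular \<open>[]\<close> is the
  signature of \<open>SO + GC\<close>.\<close>

type_synonym signature = "nat list"

inductive has_sort :: "signature \<Rightarrow> tm \<Rightarrow> sort \<Rightarrow> bool" for ms where
  "s \<noteq> Cn 0 \<Longrightarrow> has_sort ms (Var (s, j)) s"
| "has_sort ms t (Cn (n + m)) \<Longrightarrow> length us = n \<Longrightarrow> n \<ge> 1 \<Longrightarrow> m \<ge> 1 \<Longrightarrow>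
     (\<forall>u\<in>set us. has_sort ms u Ob) \<Longrightarrow> has_sort ms (Sec t us) (Cn m)"
| "i < length ms \<Longrightarrow> has_sort ms t (Cn (ms ! i)) \<Longrightarrow> has_sort ms (Abstr i t) Ob"

primrec wff :: "signature \<Rightarrow> fm \<Rightarrow> bool" where
  "wff ms Fls = True"
| "wff ms (Eq t u) = (\<exists>s. has_sort ms t s \<and> has_sort ms u s)"
| "wff ms (Less t u) = (has_sort ms t Ob \<and> has_sort ms u Ob)"
| "wff ms (Pred t us) = (has_sort ms t (Cn (length us)) \<and> (\<forall>u\<in>set us. has_sort ms u Ob))"
| "wff ms (Imp \<phi> \<psi>) = (wff ms \<phi> \<and> wff ms \<psi>)"
| "wff ms (Forall x \<phi>) = (fst x \<noteq> Cn 0 \<and> wff ms \<phi>)"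

primrec fv_tm :: "tm \<Rightarrow> var set" where
  "fv_tm (Var x) = {x}"
| "fv_tm (Sec t us) = fv_tm t \<union> \<Union> (set (map fv_tm us))"
| "fv_tm (Abstr i t) = fv_tm t"

primrec fv :: "fm \<Rightarrow> var set" where
  "fv Fls = {}"
| "fv (Eq t u) = fv_tm t \<union> fv_tm u"
| "fv (Less t u) = fv_tm t \<union> fv_tm u"
| "fv (Pred t us) = fv_tm t \<union> \<Union> (set (map fv_tm us))"
| "fv (Imp \<phi> \<psi>) = fv \<phi> \<union> fv \<psi>"
| "fv (Forall x \<phi>) = fv \<phi> - {x}"

primrec subst_tm :: "(var \<Rightarrow> tm) \<Rightarrow> tm \<Rightarrow> tm" where
  "subst_tm \<sigma> (Var x) = \<sigma> x"
| "subst_tm \<sigma> (Sec t us) = Sec (subst_tm \<sigma> t) (map (subst_tm \<sigma>) us)"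
| "subst_tm \<sigma> (Abstr i t) = Abstr i (subst_tm \<sigma> t)"

text \<open>A variable of the sort of \<open>x\<close> outside the (finite) set \<open>V\<close>.\<close>

definition fresh :: "var \<Rightarrow> var set \<Rightarrow> var" where
  "fresh x V = (if x \<in> V then (fst x, LEAST j. (fst x, j) \<notin> V) else x)"

text \<open>Simultaneous substitution; bound variables are renamed where they would capture.\<close>

primrec subst :: "(var \<Rightarrow> tm) \<Rightarrow> fm \<Rightarrow> fm" where
  "subst \<sigma> Fls = Fls"
| "subst \<sigma> (Eq t u) = Eq (subst_tm \<sigma> t) (subst_tm \<sigma> u)"
| "subst \<sigma> (Less t u) = Less (subst_tm \<sigma> t) (subst_tm \<sigma> u)"
| "subst \<sigma> (Pred t us) = Pred (subst_tm \<sigma> t) (map (subst_tm \<sigma>) us)"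
| "subst \<sigma> (Imp \<phi> \<psi>) = Imp (subst \<sigma> \<phi>) (subst \<sigma> \<psi>)"
| "subst \<sigma> (Forall x \<phi>) =
     (let y = fresh x (\<Union>z\<in>fv \<phi> - {x}. fv_tm (\<sigma> z))
      in Forall y (subst (\<sigma>(x := Var y)) \<phi>))"

abbreviation subst1 :: "fm \<Rightarrow> var \<Rightarrow> tm \<Rightarrow> fm" where
  "subst1 \<phi> x t \<equiv> subst (Var(x := t)) \<phi>"

section \<open>Provability and consistency\<close>

text \<open>A Hilbert calculus for classical many-sorted first-order logic with identity. The rule
  \<open>gen\<close> is unrestricted, so non-logical axioms with free variables (the parameters of the schemata)
  are understood as universally closed.\<close>

inductive proves :: "signature \<Rightarrow> fm set \<Rightarrow> fm \<Rightarrow> bool" for ms T where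
  ax: "\<phi> \<in> T \<Longrightarrow> proves ms T \<phi>"
| imp_k: "wff ms \<phi> \<Longrightarrow> wff ms \<psi> \<Longrightarrow> proves ms T (Imp \<phi> (Imp \<psi> \<phi>))"
| imp_s: "wff ms \<phi> \<Longrightarrow> wff ms \<psi> \<Longrightarrow> wff ms \<chi> \<Longrightarrow>
    proves ms T (Imp (Imp \<phi> (Imp \<psi> \<chi>)) (Imp (Imp \<phi> \<psi>) (Imp \<phi> \<chi>)))"
| dneg: "wff ms \<phi> \<Longrightarrow> proves ms T (Imp (Neg (Neg \<phi>)) \<phi>)"
| all_elim: "wff ms (Forall x \<phi>) \<Longrightarrow> has_sort ms t (fst x) \<Longrightarrow>
    proves ms T (Imp (Forall x \<phi>) (subst1 \<phi> x t))"
| all_imp: "wff ms \<phi> \<Longrightarrow> wff ms (Forall x \<psi>) \<Longrightarrow> x \<notin> fv \<phi> \<Longrightarrow>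
    proves ms T (Imp (Forall x (Imp \<phi> \<psi>)) (Imp \<phi> (Forall x \<psi>)))"
| eq_refl: "has_sort ms t s \<Longrightarrow> proves ms T (Eq t t)"
| eq_subst: "wff ms \<phi> \<Longrightarrow> has_sort ms t (fst x) \<Longrightarrow> has_sort ms u (fst x) \<Longrightarrow>
    proves ms T (Imp (Eq t u) (Imp (subst1 \<phi> x t) (subst1 \<phi> x u)))"
| mp: "proves ms T (Imp \<phi> \<psi>) \<Longrightarrow> proves ms T \<phi> \<Longrightarrow> proves ms T \<psi>"
| gen: "proves ms T \<phi> \<Longrightarrow> fst x \<noteq> Cn 0 \<Longrightarrow> proves ms T (Forall x \<phi>)"

definition consistent :: "signature \<Rightarrow> fm set \<Rightarrow> bool" where
  "consistent ms T \<longleftrightarrow> \<not> proves ms T Fls"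

section \<open>Axioms and schemata\<close>

definition obj_vars :: "nat \<Rightarrow> var list \<Rightarrow> bool" where
  "obj_vars n xs \<longleftrightarrow> length xs = n \<and> distinct xs \<and> (\<forall>x\<in>set xs. fst x = Ob)"

text \<open>The axioms giving the section symbols their meaning,
  \<open>R[a\<^sub>1, \<dots>, a\<^sub>n](y\<^sub>1, \<dots>, y\<^sub>m) \<leftrightarrow> R(a\<^sub>1, \<dots>, a\<^sub>n, y\<^sub>1, \<dots>, y\<^sub>m)\<close>.\<close>

definition section_axioms :: "fm set" where
  "section_axioms =
    {Forall R (Foralls (as @ ys)
       (Iff (Pred (Sec (Var R) (map Var as)) (map Var ys)) (Pred (Var R) (map Var (as @ ys)))))
     | R as ys n m. n \<ge> 1 \<and> m \<ge> 1 \<and> fst R = Cn (n + m) \<and>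
         length as = n \<and> obj_vars (n + m) (as @ ys)}"

definition extensionality :: "fm set" where
  "extensionality =
    {Forall R (Forall S (Imp
       (Foralls xs (Iff (Pred (Var R) (map Var xs)) (Pred (Var S) (map Var xs))))
       (Eq (Var R) (Var S))))
     | R S xs n. n \<ge> 1 \<and> fst R = Cn n \<and> fst S = Cn n \<and> R \<noteq> S \<and> obj_vars n xs}"

definition comprehension :: "fm set \<Rightarrow> fm set" where
  "comprehension \<Phi> =
    {Exists R (Foralls xs (Iff (Pred (Var R) (map Var xs)) \<phi>))
     | R xs n \<phi>. \<phi> \<in> \<Phi> \<and> n \<ge> 1 \<and> fst R = Cn n \<and> obj_vars n xs \<and> R \<notin> fv \<phi>}"

text \<open>Here \<open>\<phi>(xs, R[xs])\<close> is the result of substituting \<open>R[xs]\<close> for \<open>R'\<close> in \<open>\<phi>\<close>.\<close>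

definition choice :: "fm set \<Rightarrow> fm set" where
  "choice \<Phi> =
    {Imp (Foralls xs (Exists R' \<phi>))
         (Exists R (Foralls xs (subst1 \<phi> R' (Sec (Var R) (map Var xs)))))
     | R R' xs n m \<phi>. \<phi> \<in> \<Phi> \<and> n \<ge> 1 \<and> m \<ge> 1 \<and> fst R = Cn (n + m) \<and> fst R' = Cn m \<and>
         obj_vars n xs \<and> R \<notin> fv \<phi>}"

definition linear_order :: "fm set" where
  "linear_order = (let x = (Ob, 0); y = (Ob, 1); z = (Ob, 2) in
    {Forall x (Neg (Less (Var x) (Var x))),
     Forall x (Forall y (Forall z
       (Imp (And (Less (Var x) (Var y)) (Less (Var y) (Var z))) (Less (Var x) (Var z))))),
     Forall x (Forall y
       (Or (Less (Var x) (Var y)) (Or (Eq (Var x) (Var y)) (Less (Var y) (Var x)))))})"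

definition least_schema :: "fm set \<Rightarrow> fm set" where
  "least_schema \<Phi> =
    {Imp (Exists x \<phi>)
         (Exists x (And \<phi> (Forall y (Imp (Less (Var y) (Var x)) (Neg (subst1 \<phi> x (Var y)))))))
     | x y \<phi>. \<phi> \<in> \<Phi> \<and> fst x = Ob \<and> fst y = Ob \<and> x \<noteq> y \<and> y \<notin> fv \<phi>}"

primrec first_order :: "fm \<Rightarrow> bool" where
  "first_order Fls = True"
| "first_order (Eq t u) = True"
| "first_order (Less t u) = True"
| "first_order (Pred t us) = True"
| "first_order (Imp \<phi> \<psi>) = (first_order \<phi> \<and> first_order \<psi>)"
| "first_order (Forall x \<phi>) = (fst x = Ob \<and> first_order \<phi>)"

inductive sigma11 :: "fm \<Rightarrow> bool" where
  "first_order \<phi> \<Longrightarrow> sigma11 \<phi>"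
| "sigma11 \<phi> \<Longrightarrow> fst R = Cn n \<Longrightarrow> n \<ge> 1 \<Longrightarrow> sigma11 (Exists R \<phi>)"

section \<open>The theories\<close>

text \<open>\<open>SO\<close> is given in the form it takes in \<open>SO + GC\<close>, where comprehension formulas may contain
  \<open><\<close> but no abstraction operators.\<close>

definition SO :: "fm set" where
  "SO = section_axioms \<union> extensionality \<union> comprehension {\<phi>. wff [] \<phi>}"

definition GC :: "signature \<Rightarrow> fm set" where
  "GC ms = linear_order \<union> least_schema {\<phi>. wff ms \<phi>}"

definition abstraction :: "nat \<Rightarrow> var \<Rightarrow> var \<Rightarrow> fm \<Rightarrow> fm" where
  "abstraction i R S E =
    Forall R (Forall S (Iff (Eq (Abstr i (Var R)) (Abstr i (Var S))) E))"

text \<open>\<open>E i\<close>, with its free variables \<open>R i\<close> and \<open>S i\<close>, is the formula whose abstraction operator is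
  \<open>Abstr i\<close>.\<close>

definition Sigma11_A ::
  "signature \<Rightarrow> (nat \<Rightarrow> var) \<Rightarrow> (nat \<Rightarrow> var) \<Rightarrow> (nat \<Rightarrow> fm) \<Rightarrow> fm set" where
  "Sigma11_A ms R S E =
    {abstraction i (R i) (S i) (E i) | i. i < length ms} \<union>
    comprehension {\<phi>. wff ms \<phi> \<and> first_order \<phi>} \<union>
    choice {\<phi>. wff ms \<phi> \<and> sigma11 \<phi>}"

text \<open>The sentence saying that \<open>E(R, S)\<close> is an equivalence relation on \<open>m\<close>-ary concepts.\<close>

definition equivalence :: "nat \<Rightarrow> var \<Rightarrow> var \<Rightarrow> fm \<Rightarrow> fm" where
  "equivalence m R S E =
    (let X = (Cn m, 0); Y = (Cn m, 1); Z = (Cn m, 2);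
         E' = (\<lambda>P Q. subst (Var(R := Var P, S := Var Q)) E)
     in And (Forall X (E' X X))
       (And (Forall X (Forall Y (Imp (E' X Y) (E' Y X))))
            (Forall X (Forall Y (Forall Z (Imp (And (E' X Y) (E' Y Z)) (E' X Z)))))))"

end

(* The model has the natural numbers as objects and a countable family F of sets of tuples as
   concepts, F being elementary in the family of all concepts for formulas without abstraction
   operators; there SO + GC holds and the E_i are equivalence relations. Codes for the classes of
   the E_i are added by forcing: a condition is a countable family with codes for its classes
   and an infinite reserve of unused codes. First-order formulas are absolute between a condition and
   its extensions, since the objects stay the same, and Sigma^1_1 formulas persist. So first-order
   comprehension is met by adding the defined set. For an instance of choice, either some condition
   excludes a witness for some argument in all its extensions, so that the premise fails in the
   generic model, or witnesses can be added for all arguments one after the other; setting aside one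
   code of the reserve at each step makes the limit a condition again. *)

theory Submission
  imports Defs "HOL-Library.Countable_Set"
begin

section \<open>Henkin semantics over the natural numbers\<close>

text \<open>The family of all concepts satisfies \<open>SO + GC\<close>, but a relation such as
  identity of concepts has uncountably many classes there, too many for codes among the natural
  numbers; this forces countable families. Elementarity makes E_i hold between members of the family
  exactly when it holds between them in the family of all concepts, so the relations to be coded are
  fixed in advance and no enlargement of the family invalidates a code. The order of the objects is
  that of the natural numbers, so the least-element schema costs nothing, even for second-order
  formulas with abstraction operators. The obstacle is room for codes: a limit of conditions could
  use up all numbers, and the concept collecting the witnesses of choice, which can only be formed
  at the limit, would find no codes for itself and its sections. The absence of a witness is not
  persistent, so the negative case of choice has to speak of all extensions; it applies to the
  generic model because that model, being a countable limit, is again a condition.\<close>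

type_synonym concept = "nat list set"

datatype val = Num (the_num: nat) | Con (the_con: concept)

definition sec :: "concept \<Rightarrow> nat list \<Rightarrow> concept" where
  "sec X as = {ys. as @ ys \<in> X}"

text \<open>The empty set is a concept of every arity; the sorts need not be disjoint.\<close>

definition concepts :: "concept set \<Rightarrow> nat \<Rightarrow> concept set" where
  "concepts F n = {X \<in> F. \<forall>as\<in>X. length as = n}"

text \<open>\<open>Cn 0\<close> gets a range as well, so that assignments can be total.\<close>

primrec range_of :: "concept set \<Rightarrow> sort \<Rightarrow> val set" where
  "range_of F Ob = range Num"
| "range_of F (Cn n) = Con ` concepts F n"

text \<open>\<open>d i X\<close> is the value of the \<open>i\<close>-th abstraction operator at
  \<open>X\<close>. Evaluation ignores sorts: on ill-sorted terms \<open>the_num\<close> and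
  \<open>the_con\<close> may yield unspecified values; \<open>den_dom\<close> takes care of the
  well-sorted ones.\<close>

primrec den :: "(nat \<Rightarrow> concept \<Rightarrow> nat) \<Rightarrow> (var \<Rightarrow> val) \<Rightarrow> tm \<Rightarrow> val" where
  "den d e (Var x) = e x"
| "den d e (Sec t us) = Con (sec (the_con (den d e t)) (map the_num (map (den d e) us)))"
| "den d e (Abstr i t) = Num (d i (the_con (den d e t)))"

primrec sat :: "concept set \<Rightarrow> (nat \<Rightarrow> concept \<Rightarrow> nat) \<Rightarrow> (var \<Rightarrow> val) \<Rightarrow> fm \<Rightarrow> bool" where
  "sat F d e Fls = False"
| "sat F d e (Eq t u) = (den d e t = den d e u)"
| "sat F d e (Less t u) = (the_num (den d e t) < the_num (den d e u))"
| "sat F d e (Pred t us) = (map the_num (map (den d e) us) \<in> the_con (den d e t))"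
| "sat F d e (Imp \<phi> \<psi>) = (sat F d e \<phi> \<longrightarrow> sat F d e \<psi>)"
| "sat F d e (Forall x \<phi>) = (\<forall>v\<in>range_of F (fst x). sat F d (e(x := v)) \<phi>)"

definition assignment :: "concept set \<Rightarrow> (var \<Rightarrow> val) \<Rightarrow> bool" where
  "assignment F e \<longleftrightarrow> (\<forall>x. e x \<in> range_of F (fst x))"

definition section_closed :: "concept set \<Rightarrow> bool" where
  "section_closed F \<longleftrightarrow> (\<forall>X\<in>F. \<forall>as. sec X as \<in> F)"

lemma section_closed_UNIV [simp]: "section_closed UNIV"
  by (simp add: section_closed_def)

lemma sec_append: "sec (sec X as) bs = sec X (as @ bs)"
  by (simp add: sec_def)

lemma sec_Nil [simp]: "sec X [] = X"
  by (simp add: sec_def)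

lemma sec_concepts:
  assumes "section_closed F" "X \<in> concepts F (length as + m)"
  shows "sec X as \<in> concepts F m"
  using assms by (force simp: concepts_def section_closed_def sec_def)

lemma concepts_mono: "F \<subseteq> G \<Longrightarrow> concepts F n \<subseteq> concepts G n"
  by (auto simp: concepts_def)

lemma range_of_mono: "F \<subseteq> G \<Longrightarrow> range_of F s \<subseteq> range_of G s"
  using concepts_mono[of F G] by (cases s) auto

lemma assignment_mono: "F \<subseteq> G \<Longrightarrow> assignment F e \<Longrightarrow> assignment G e"
  unfolding assignment_def using range_of_mono[of F G] by blast

lemma assignment_upd:
  "assignment F e \<Longrightarrow> v \<in> range_of F (fst x) \<Longrightarrow> assignment F (e(x := v))"
  by (auto simp: assignment_def)

text \<open>The empty set belongs to every concept sort, so a single default serves them all. Some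
  assignment must exist for the validity of \<open>Fls\<close> to be absurd.\<close>

lemma assignment_default:
  "{} \<in> F \<Longrightarrow> assignment F (\<lambda>x. if fst x = Ob then Num 0 else Con {})"
  unfolding assignment_def
proof (intro allI)
  fix x :: var
  assume "{} \<in> F"
  then show "(if fst x = Ob then Num 0 else Con {}) \<in> range_of F (fst x)"
    by (cases "fst x") (auto simp: concepts_def)
qed

lemma den_dom:
  assumes "section_closed F" "assignment F e"
  shows "has_sort ms t s \<Longrightarrow> den d e t \<in> range_of F s"
proof (induction rule: has_sort.induct)
  case (1 s j)
  then show ?case using assms by (auto simp: assignment_def)
next
  case (2 t n m us)
  from 2 obtain X where X: "den d e t = Con X" "X \<in> concepts F (n + m)" by auto
  with 2 sec_concepts[OF assms(1), of X "map the_num (map (den d e) us)" m] show ?case by simp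
qed auto

section \<open>Coincidence and substitution\<close>

lemma finite_fv_tm: "finite (fv_tm t)"
  by (induction t) auto

lemma finite_fv: "finite (fv \<phi>)"
  by (induction \<phi>) (auto simp: finite_fv_tm)

lemma den_cong: "(\<And>x. x \<in> fv_tm t \<Longrightarrow> e x = e' x) \<Longrightarrow> den d e t = den d e' t"
proof (induction t)
  case (Sec t us)
  then have "den d e t = den d e' t" "map (den d e) us = map (den d e') us" by auto
  then show ?case by (simp only: den.simps)
qed auto

lemma sat_cong: "(\<And>x. x \<in> fv \<phi> \<Longrightarrow> e x = e' x) \<Longrightarrow> sat F d e \<phi> = sat F d e' \<phi>"
proof (induction \<phi> arbitrary: e e')
  case (Eq t u)
  then have "den d e t = den d e' t" "den d e u = den d e' u" by (auto intro: den_cong)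
  then show ?case by simp
next
  case (Less t u)
  then have "den d e t = den d e' t" "den d e u = den d e' u" by (auto intro: den_cong)
  then show ?case by simp
next
  case (Pred t us)
  then have "den d e t = den d e' t" "map (den d e) us = map (den d e') us"
    by (auto intro!: den_cong)
  then show ?case by (simp only: sat.simps)
next
  case (Imp \<phi> \<psi>)
  have "sat F d e \<phi> = sat F d e' \<phi>" "sat F d e \<psi> = sat F d e' \<psi>"
    by (rule Imp.IH; use Imp.prems in simp)+
  then show ?case by simp
next
  case (Forall x \<phi>)
  have "sat F d (e(x := v)) \<phi> = sat F d (e'(x := v)) \<phi>" for v
    by (rule Forall.IH) (use Forall.prems in auto)
  then show ?case by simp
qed auto

lemma den_subst: "den d e (subst_tm \<sigma> t) = den d (\<lambda>x. den d e (\<sigma> x)) t"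
proof (induction t)
  case (Sec t us)
  then have "map (den d e) (map (subst_tm \<sigma>) us) = map (den d (\<lambda>x. den d e (\<sigma> x))) us" by auto
  with Sec show ?case by (simp only: den.simps subst_tm.simps)
qed auto

lemma fst_fresh: "fst (fresh x V) = fst x"
  by (simp add: fresh_def)

lemma fresh_notin:
  assumes "finite V"
  shows "fresh x V \<notin> V"
proof -
  have "finite {j. (fst x, j) \<in> V}"
    using finite_imageI[OF assms, of snd] by (rule rev_finite_subset) force
  then obtain j where "(fst x, j) \<notin> V"
    by (metis (mono_tags, lifting) ex_new_if_finite infinite_UNIV_nat mem_Collect_eq)
  then have "(fst x, LEAST j. (fst x, j) \<notin> V) \<notin> V" by (rule LeastI)
  then show ?thesis by (simp add: fresh_def)
qed

lemma sat_subst: "sat F d e (subst \<sigma> \<phi>) = sat F d (\<lambda>x. den d e (\<sigma> x)) \<phi>"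
proof (induction \<phi> arbitrary: \<sigma> e)
  case (Pred t us)
  have "map (den d e) (map (subst_tm \<sigma>) us) = map (den d (\<lambda>x. den d e (\<sigma> x))) us"
    by (simp add: den_subst)
  then show ?case by (simp only: sat.simps subst.simps den_subst)
next
  case (Forall x \<phi>)
  let ?V = "\<Union>z\<in>fv \<phi> - {x}. fv_tm (\<sigma> z)"
  define y where "y = fresh x ?V"
  have y: "y \<notin> ?V" unfolding y_def
    by (rule fresh_notin) (simp add: finite_fv finite_fv_tm)
  \<comment> \<open>Only the free variables of \<open>\<phi>\<close> count. The terms substituted
    for those other than \<open>x\<close> do not contain \<open>y\<close>, so giving
    \<open>y\<close> the value \<open>v\<close> leaves their denotations alone.\<close>
  have "sat F d (\<lambda>z. den d (e(y := v)) ((\<sigma>(x := Var y)) z)) \<phi> =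
        sat F d ((\<lambda>z. den d e (\<sigma> z))(x := v)) \<phi>" for v
  proof (rule sat_cong)
    fix z assume z: "z \<in> fv \<phi>"
    show "den d (e(y := v)) ((\<sigma>(x := Var y)) z) = ((\<lambda>z. den d e (\<sigma> z))(x := v)) z"
    proof (cases "z = x")
      case False
      with z y have "y \<notin> fv_tm (\<sigma> z)" by auto
      then have "den d (e(y := v)) (\<sigma> z) = den d e (\<sigma> z)" by (intro den_cong) auto
      with False show ?thesis by simp
    qed simp
  qed
  moreover have "fst y = fst x" by (simp add: y_def fst_fresh)
  ultimately show ?case by (simp only: subst.simps Let_def sat.simps Forall.IH flip: y_def)
qed (auto simp: den_subst)

lemma sat_subst1: "sat F d e (subst1 \<phi> x t) = sat F d (e(x := den d e t)) \<phi>"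
  unfolding sat_subst by (rule sat_cong) auto

section \<open>Soundness of the calculus\<close>

definition valid :: "concept set \<Rightarrow> (nat \<Rightarrow> concept \<Rightarrow> nat) \<Rightarrow> fm \<Rightarrow> bool" where
  "valid F d \<phi> \<longleftrightarrow> (\<forall>e. assignment F e \<longrightarrow> sat F d e \<phi>)"

text \<open>Validity refers to all assignments, which is what \<open>gen\<close> asks for. Section
  closure enters through \<open>all_elim\<close>: the value of the instantiating term has to lie in
  the range of the quantifier.\<close>

lemma soundness:
  assumes "section_closed F" and T: "\<And>\<phi>. \<phi> \<in> T \<Longrightarrow> valid F d \<phi>"
  shows "proves ms T \<phi> \<Longrightarrow> valid F d \<phi>"
proof (induction rule: proves.induct)
  case (all_elim x \<phi> t)
  then show ?case
    using den_dom[OF assms(1)] by (auto simp: valid_def sat_subst1)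
next
  case (all_imp \<phi> x \<psi>)
  have "sat F d (e(x := v)) \<phi> = sat F d e \<phi>" for e v
    using all_imp by (intro sat_cong) auto
  then show ?case by (auto simp: valid_def)
next
  case (gen \<phi> x)
  then show ?case by (auto simp: valid_def intro: assignment_upd)
qed (auto simp: valid_def sat_subst1 T[unfolded valid_def])

lemma consistent_if_valid:
  assumes "section_closed F" "{} \<in> F" "\<And>\<phi>. \<phi> \<in> T \<Longrightarrow> valid F d \<phi>"
  shows "consistent ms T"
  using soundness[OF assms(1,3)] assignment_default[OF assms(2)]
  by (fastforce simp: consistent_def valid_def)

section \<open>Validity of sections, extensionality, comprehension and the order axioms\<close>

fun upds :: "(var \<Rightarrow> val) \<Rightarrow> var list \<Rightarrow> nat list \<Rightarrow> var \<Rightarrow> val" where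
  "upds e (x # xs) (a # as) = upds (e(x := Num a)) xs as"
| "upds e _ _ = e"

lemma upds_other: "x \<notin> set xs \<Longrightarrow> upds e xs as x = e x"
  by (induction e xs as rule: upds.induct) auto

lemma map_upds:
  "distinct xs \<Longrightarrow> length as = length xs \<Longrightarrow> map (upds e xs as) xs = map Num as"
  by (induction e xs as rule: upds.induct) (auto simp: upds_other)

lemma upds_cong: "e x = e' x \<Longrightarrow> upds e xs as x = upds e' xs as x"
proof (induction e xs as arbitrary: e' rule: upds.induct)
  case (1 e y xs a as)
  have "upds (e(y := Num a)) xs as x = upds (e'(y := Num a)) xs as x"
    by (rule "1.IH") (use "1.prems" in auto)
  then show ?case by simp
qed auto

lemma assignment_upds:
  "assignment F e \<Longrightarrow> \<forall>x\<in>set xs. fst x = Ob \<Longrightarrow> assignment F (upds e xs as)"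
  by (induction e xs as rule: upds.induct) (auto simp: assignment_upd)

lemma sat_Foralls:
  "\<forall>x\<in>set xs. fst x = Ob \<Longrightarrow>
   sat F d e (Foralls xs \<phi>) \<longleftrightarrow> (\<forall>as. length as = length xs \<longrightarrow> sat F d (upds e xs as) \<phi>)"
proof (induction xs arbitrary: e)
  case (Cons x xs)
  then have "sat F d e (Foralls (x # xs) \<phi>) \<longleftrightarrow>
      (\<forall>a as. length as = length xs \<longrightarrow> sat F d (upds e (x # xs) (a # as)) \<phi>)"
    by simp
  also have "\<dots> \<longleftrightarrow> (\<forall>as. length as = length (x # xs) \<longrightarrow> sat F d (upds e (x # xs) as) \<phi>)"
    by (metis length_Suc_conv length_Cons)
  finally show ?case .
qed auto

lemma map_the_num_upds:
  "obj_vars n xs \<Longrightarrow> length as = n \<Longrightarrow> map (the_num \<circ> upds e xs as) xs = as"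
  using map_upds[of xs as e]
  by (simp add: obj_vars_def flip: map_map) (simp add: comp_def)

lemma valid_section_axioms:
  assumes "\<phi> \<in> section_axioms"
  shows "valid F d \<phi>"
proof -
  obtain R as ys n m where \<phi>: "\<phi> = Forall R (Foralls (as @ ys)
       (Iff (Pred (Sec (Var R) (map Var as)) (map Var ys)) (Pred (Var R) (map Var (as @ ys)))))"
    and R: "fst R = Cn (n + m)" and ov: "obj_vars (n + m) (as @ ys)"
    using assms unfolding section_axioms_def by blast
  have "\<forall>x\<in>set (as @ ys). fst x = Ob" using ov by (simp add: obj_vars_def)
  then show ?thesis
    unfolding valid_def \<phi> by (auto simp: sat_Foralls sec_def comp_def simp del: foldr_append)
qed

text \<open>A concept of arity \<open>n\<close> contains lists of length \<open>n\<close> only, so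
  agreement on all \<open>n\<close>-tuples is equality of sets.\<close>

lemma valid_extensionality:
  assumes "\<phi> \<in> extensionality"
  shows "valid F d \<phi>"
proof -
  obtain R S xs n where \<phi>: "\<phi> = Forall R (Forall S (Imp
       (Foralls xs (Iff (Pred (Var R) (map Var xs)) (Pred (Var S) (map Var xs))))
       (Eq (Var R) (Var S))))"
    and RS: "fst R = Cn n" "fst S = Cn n" "R \<noteq> S" and ov: "obj_vars n xs"
    using assms unfolding extensionality_def by blast
  have ob: "\<forall>x\<in>set xs. fst x = Ob" and len: "length xs = n" using ov by (auto simp: obj_vars_def)
  have "R \<notin> set xs" "S \<notin> set xs" using ob RS by auto
  then show ?thesis
    unfolding valid_def \<phi> using RS ov ob len
    by (auto simp: sat_Foralls upds_other map_the_num_upds comp_def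
        map_the_num_upds[unfolded comp_def] concepts_def)
qed

definition extension :: "concept set \<Rightarrow> (nat \<Rightarrow> concept \<Rightarrow> nat) \<Rightarrow> (var \<Rightarrow> val) \<Rightarrow> var list \<Rightarrow> fm \<Rightarrow> concept"
  where "extension F d e xs \<phi> = {as. length as = length xs \<and> sat F d (upds e xs as) \<phi>}"

text \<open>Reduces an instance of comprehension to the membership of one set in the family. As
  \<open>R\<close> is not free in \<open>\<phi>\<close>, assigning that set to \<open>R\<close> does
  not change what \<open>\<phi>\<close> defines.\<close>

lemma sat_comprehension:
  assumes "fst R = Cn n" "obj_vars n xs" "R \<notin> fv \<phi>" "extension F d e xs \<phi> \<in> F"
  shows "sat F d e (Exists R (Foralls xs (Iff (Pred (Var R) (map Var xs)) \<phi>)))"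
proof -
  let ?X = "extension F d e xs \<phi>"
  have ob: "\<forall>x\<in>set xs. fst x = Ob" and len: "length xs = n" using assms by (auto simp: obj_vars_def)
  have R: "R \<notin> set xs" using ob assms by auto
  have X: "?X \<in> concepts F n" using assms(4) len by (auto simp: concepts_def extension_def)
  have "sat F d (upds (e(R := Con ?X)) xs as) \<phi> = sat F d (upds e xs as) \<phi>" for as
    using assms(3) by (intro sat_cong upds_cong) auto
  then have "sat F d (e(R := Con ?X)) (Foralls xs (Iff (Pred (Var R) (map Var xs)) \<phi>))"
    using R len ob assms(2) by (auto simp: sat_Foralls upds_other
        map_the_num_upds[unfolded comp_def] comp_def extension_def)
  with X assms(1) show ?thesis by auto
qed

lemma valid_linear_order: "\<phi> \<in> linear_order \<Longrightarrow> valid F d \<phi>"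
  by (auto simp: linear_order_def Let_def valid_def)

text \<open>The order is a well-order seen from outside, so a least number satisfying
  \<open>\<psi>\<close> exists whatever \<open>\<psi>\<close> is; hence the arbitrary
  \<open>\<Phi>\<close>.\<close>

lemma valid_least_schema:
  assumes "\<phi> \<in> least_schema \<Phi>"
  shows "valid F d \<phi>"
proof -
  obtain x y \<psi> where \<phi>: "\<phi> = Imp (Exists x \<psi>)
         (Exists x (And \<psi> (Forall y (Imp (Less (Var y) (Var x)) (Neg (subst1 \<psi> x (Var y)))))))"
    and xy: "fst x = Ob" "fst y = Ob" "x \<noteq> y" "y \<notin> fv \<psi>"
    using assms unfolding least_schema_def by blast
  have upd: "sat F d (e(y := w, x := w)) \<psi> = sat F d (e(x := w)) \<psi>" for e w
    using xy by (intro sat_cong) auto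
  have "sat F d e (Exists x (And \<psi> (Forall y (Imp (Less (Var y) (Var x)) (Neg (subst1 \<psi> x (Var y)))))))"
    if "sat F d (e(x := Num a)) \<psi>" for e a
  proof -
    define b where "b = (LEAST b. sat F d (e(x := Num b)) \<psi>)"
    have "sat F d (e(x := Num b)) \<psi>" unfolding b_def using that by (rule LeastI)
    moreover have "\<not> sat F d (e(x := Num c)) \<psi>" if "c < b" for c
      using that unfolding b_def by (rule not_less_Least)
    ultimately show ?thesis using xy(1,2,3) by (auto simp: sat_subst1 upd intro!: exI[of _ b])
  qed
  then show ?thesis unfolding \<phi> valid_def using xy(1,2,3) by auto
qed

text \<open>With all sets of tuples present, every set that comprehension asks for is there. This
  standard model turns the provable equivalence of the E_i into actual equivalence
  relations.\<close>

lemma valid_SO_GC_UNIV: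
  assumes "\<phi> \<in> SO \<union> GC []"
  shows "valid UNIV d \<phi>"
proof -
  consider "\<phi> \<in> section_axioms" | "\<phi> \<in> extensionality" | "\<phi> \<in> comprehension {\<phi>. wff [] \<phi>}"
    | "\<phi> \<in> linear_order" | "\<phi> \<in> least_schema {\<phi>. wff [] \<phi>}"
    using assms by (auto simp: SO_def GC_def)
  then show ?thesis
  proof cases
    case 3
    then show ?thesis unfolding comprehension_def valid_def
      using sat_comprehension[where F = UNIV] by blast
  qed (simp_all add: valid_section_axioms valid_extensionality valid_linear_order valid_least_schema)
qed

subsection \<open>Absoluteness\<close>

lemma den_agree:
  assumes "section_closed F" "assignment F e"
    and "\<And>i X. i < length ms \<Longrightarrow> X \<in> concepts F (ms ! i) \<Longrightarrow> d i X = d' i X"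
  shows "has_sort ms t s \<Longrightarrow> den d e t = den d' e t"
proof (induction rule: has_sort.induct)
  case (2 t n m us)
  then have "map (den d e) us = map (den d' e) us" by auto
  with 2 show ?case by (simp only: den.simps)
next
  case (3 i t)
  \<comment> \<open>Section closure keeps the argument of the operator inside \<open>F\<close>,
    where the two code functions agree.\<close>
  have "den d e t \<in> range_of F (Cn (ms ! i))"
    using den_dom[OF assms(1,2)] 3 by blast
  with 3 assms(3) show ?case by auto
qed auto

lemma sat_atom_agree:
  assumes "section_closed F" "assignment F e"
    and "\<And>i X. i < length ms \<Longrightarrow> X \<in> concepts F (ms ! i) \<Longrightarrow> d i X = d' i X"
  shows "wff ms (Eq t u) \<Longrightarrow> sat F d e (Eq t u) = sat G d' e (Eq t u)"
    and "wff ms (Less t u) \<Longrightarrow> sat F d e (Less t u) = sat G d' e (Less t u)"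
    and "wff ms (Pred t us) \<Longrightarrow> sat F d e (Pred t us) = sat G d' e (Pred t us)"
proof -
  note * = den_agree[where d = d and d' = d', OF assms]
  show "wff ms (Eq t u) \<Longrightarrow> sat F d e (Eq t u) = sat G d' e (Eq t u)" by (auto simp: *)
  show "wff ms (Less t u) \<Longrightarrow> sat F d e (Less t u) = sat G d' e (Less t u)" by (auto simp: *)
  assume "wff ms (Pred t us)"
  then have "map (den d e) us = map (den d' e) us" "den d e t = den d' e t" by (auto simp: *)
  then show "sat F d e (Pred t us) = sat G d' e (Pred t us)" by (simp only: sat.simps)
qed

lemma sat_first_order_agree:
  assumes "section_closed F"
    and "\<And>i X. i < length ms \<Longrightarrow> X \<in> concepts F (ms ! i) \<Longrightarrow> d i X = d' i X"
  shows "wff ms \<phi> \<Longrightarrow> first_order \<phi> \<Longrightarrow> assignment F e \<Longrightarrow> sat F d e \<phi> = sat G d' e \<phi>"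
proof (induction \<phi> arbitrary: e)
  case (Forall x \<phi>)
  then have "assignment F (e(x := Num a))" for a by (intro assignment_upd) auto
  with Forall show ?case by auto
next
  case (Imp \<phi> \<psi>)
  then show ?case by simp
qed (simp, (rule sat_atom_agree[OF assms(1) _ assms(2)]; assumption)+)

lemma sat_sigma11_mono:
  assumes "section_closed F" "F \<subseteq> G"
    and "\<And>i X. i < length ms \<Longrightarrow> X \<in> concepts F (ms ! i) \<Longrightarrow> d i X = d' i X"
  shows "sigma11 \<phi> \<Longrightarrow> wff ms \<phi> \<Longrightarrow> assignment F e \<Longrightarrow> sat F d e \<phi> \<Longrightarrow> sat G d' e \<phi>"
proof (induction arbitrary: e rule: sigma11.induct)
  case (1 \<phi>)
  then show ?case using sat_first_order_agree[OF assms(1), of ms d d' \<phi> e G] assms(3) by blast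
next
  case (2 \<phi> R n)
  then obtain v where v: "v \<in> range_of F (fst R)" "sat F d (e(R := v)) \<phi>" by auto
  have "assignment F (e(R := v))" by (rule assignment_upd[OF "2.prems"(2) v(1)])
  with 2 v(2) have "sat G d' (e(R := v)) \<phi>" by simp
  moreover have "v \<in> range_of G (fst R)" using v range_of_mono[OF assms(2)] by blast
  ultimately show ?case by auto
qed

text \<open>The Tarski--Vaught test, with the family of all concepts as the larger structure.
  Well-formedness over \<open>[]\<close> rules out abstraction operators, so \<open>d\<close> and
  \<open>d'\<close> may be unrelated.\<close>

lemma sat_elementary:
  assumes F: "section_closed F"
    and TV: "\<And>\<phi> x e v. wff [] \<phi> \<Longrightarrow> fst x \<noteq> Cn 0 \<Longrightarrow> assignment F e \<Longrightarrow> v \<in> range_of UNIV (fst x) \<Longrightarrow>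
      sat UNIV d' (e(x := v)) \<phi> \<Longrightarrow> \<exists>w\<in>range_of F (fst x). sat UNIV d' (e(x := w)) \<phi>"
  shows "wff [] \<phi> \<Longrightarrow> assignment F e \<Longrightarrow> sat F d e \<phi> = sat UNIV d' e \<phi>"
proof (induction \<phi> arbitrary: e)
  case (Forall x \<phi>)
  have "sat F d e (Forall x \<phi>) = (\<forall>w\<in>range_of F (fst x). sat UNIV d' (e(x := w)) \<phi>)"
    using Forall by (auto simp: assignment_upd)
  \<comment> \<open>Applied to \<open>Neg \<phi>\<close>, the test moves a counterexample from the
    full range into \<open>F\<close>.\<close>
  also have "\<dots> = sat UNIV d' e (Forall x \<phi>)"
    using TV[of "Neg \<phi>" x e] Forall.prems range_of_mono[of F UNIV "fst x"] by auto
  finally show ?case .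
next
  case (Imp \<phi> \<psi>)
  then show ?case by simp
qed (simp, (rule sat_atom_agree[OF F, where ms = "[]"]; simp)+)

section \<open>Forcing with countable families of concepts\<close>

datatype cond = Cond (family: "concept set") (code: "nat \<Rightarrow> concept \<Rightarrow> nat") (reserve: "nat set")

text \<open>\<open>eqv i\<close> will be the relation that E_i defines in the standard model. It is
  given on all concepts at once, so it does not change while families grow.\<close>

locale forcing =
  fixes ms :: signature and eqv :: "nat \<Rightarrow> concept \<Rightarrow> concept \<Rightarrow> bool"
  assumes eqv_refl: "\<And>i X. i < length ms \<Longrightarrow> X \<in> concepts UNIV (ms ! i) \<Longrightarrow> eqv i X X"
    and eqv_sym: "\<And>i X Y. i < length ms \<Longrightarrow> X \<in> concepts UNIV (ms ! i) \<Longrightarrow>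
      Y \<in> concepts UNIV (ms ! i) \<Longrightarrow> eqv i X Y \<Longrightarrow> eqv i Y X"
    and eqv_trans: "\<And>i X Y Z. i < length ms \<Longrightarrow> X \<in> concepts UNIV (ms ! i) \<Longrightarrow>
      Y \<in> concepts UNIV (ms ! i) \<Longrightarrow> Z \<in> concepts UNIV (ms ! i) \<Longrightarrow>
      eqv i X Y \<Longrightarrow> eqv i Y Z \<Longrightarrow> eqv i X Z"
begin

definition codes :: "cond \<Rightarrow> nat set" where
  "codes p = {code p i X | i X. i < length ms \<and> X \<in> concepts (family p) (ms ! i)}"

text \<open>Codes are compared only within one operator; different operators may share
  codes.\<close>

definition condition :: "cond \<Rightarrow> bool" where
  "condition p \<longleftrightarrow> countable (family p) \<and> section_closed (family p) \<and> {} \<in> family p \<and>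
     infinite (reserve p) \<and> codes p \<inter> reserve p = {} \<and>
     (\<forall>i<length ms. \<forall>X\<in>concepts (family p) (ms ! i). \<forall>Y\<in>concepts (family p) (ms ! i).
        code p i X = code p i Y \<longleftrightarrow> eqv i X Y)"

definition extends :: "cond \<Rightarrow> cond \<Rightarrow> bool" where
  "extends q p \<longleftrightarrow> family p \<subseteq> family q \<and> reserve q \<subseteq> reserve p \<and> codes q \<subseteq> codes p \<union> reserve p \<and>
     (\<forall>i<length ms. \<forall>X\<in>concepts (family p) (ms ! i). code q i X = code p i X)"

text \<open>The code removed here is set aside for the reserve of the limit in the fusion argument.\<close>

definition shrink :: "cond \<Rightarrow> cond" where
  "shrink p = Cond (family p) (code p) (reserve p - {LEAST a. a \<in> reserve p})"

lemma codesI: "i < length ms \<Longrightarrow> X \<in> concepts (family p) (ms ! i) \<Longrightarrow> code p i X \<in> codes p"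
  by (auto simp: codes_def)

lemma extends_refl: "extends p p"
  by (auto simp: extends_def)

lemma extends_trans: "extends r q \<Longrightarrow> extends q p \<Longrightarrow> extends r p"
  unfolding extends_def using concepts_mono[of "family p" "family q"] by (simp add: subset_iff) blast

lemma codes_Cond: "codes (Cond (family p) (code p) A) = codes p"
  by (simp add: codes_def)

lemma condition_shrink: "condition p \<Longrightarrow> condition (shrink p)"
  unfolding shrink_def condition_def by (auto simp: codes_Cond)

lemma extends_shrink: "extends (shrink p) p"
  by (auto simp: extends_def shrink_def codes_Cond)

lemma family_shrink [simp]: "family (shrink p) = family p"
  by (simp add: shrink_def)

text \<open>The number \<open>a n\<close> leaves the reserve after stage \<open>n\<close> and can
  never become a code, so the numbers \<open>a n\<close> survive as a reserve for the union. To lie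
  below stage \<open>n\<close>, only those with index at least \<open>n\<close> may be kept; hence
  \<open>A\<close> depends on \<open>n\<close> while \<open>d\<close> does not.\<close>

lemma fusion:
  assumes cond: "\<And>n. condition (p n)" and ext: "\<And>n. extends (p (Suc n)) (shrink (p n))"
  obtains d where "\<And>n. \<exists>A. condition (Cond (\<Union>n. family (p n)) d A) \<and>
      extends (Cond (\<Union>n. family (p n)) d A) (p n)"
proof -
  let ?F = "\<Union>n. family (p n)"
  \<comment> \<open>The code is read off at the first stage containing \<open>X\<close>; later
    stages never change it.\<close>
  define d where "d i X = code (p (LEAST n. X \<in> family (p n))) i X" for i X
  define a where "a n = (LEAST a. a \<in> reserve (p n))" for n
  have mono: "extends (p j) (p n)" if "n \<le> j" for n j
    using that
  proof (induction rule: dec_induct)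
    case (step j)
    then show ?case using ext extends_shrink extends_trans by blast
  qed (rule extends_refl)
  have mono': "extends (p j) (shrink (p n))" if "n < j" for n j
    using ext mono extends_trans that by (meson Suc_leI)
  have a: "a n \<in> reserve (p n)" for n
    unfolding a_def by (rule LeastI_ex) (use cond[of n] in \<open>auto simp: condition_def dest: infinite_imp_nonempty\<close>)
  have fam: "family (p n) \<subseteq> family (p j)" if "n \<le> j" for n j
    using mono[OF that] by (simp add: extends_def)
  have a_codes: "a n \<notin> codes (p j)" for n j
  proof (cases "n < j")
    case True
    have "a n \<notin> codes (p n)" using a[of n] cond[of n] by (auto simp: condition_def)
    moreover have "codes (p j) \<subseteq> codes (p n) \<union> (reserve (p n) - {a n})"
      using mono'[OF True] by (simp add: extends_def shrink_def codes_Cond a_def)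
    ultimately show ?thesis by blast
  next
    case False
    then have "reserve (p n) \<subseteq> reserve (p j)" using mono by (simp add: extends_def)
    with a[of n] cond[of j] show ?thesis by (auto simp: condition_def)
  qed
  have a_neq: "a j \<noteq> a n" if "n < j" for n j
    using mono'[OF that] a[of j] by (auto simp: extends_def shrink_def a_def)
  have inj: "inj a" by (rule linorder_injI) (use a_neq in metis)
  have d: "d i X = code (p n) i X" if "i < length ms" "X \<in> concepts (family (p n)) (ms ! i)" for i n X
  proof -
    define l where "l = (LEAST n. X \<in> family (p n))"
    have X: "X \<in> family (p n)" using that by (simp add: concepts_def)
    have "X \<in> family (p l)" unfolding l_def by (rule LeastI, rule X)
    moreover have "l \<le> n" unfolding l_def by (rule Least_le, rule X)
    ultimately show ?thesis
      using mono[of l n] that by (auto simp: d_def extends_def concepts_def simp flip: l_def)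
  qed
  have conc: "\<exists>j\<ge>n. X \<in> concepts (family (p j)) k" if X: "X \<in> concepts ?F k" for X k n
  proof -
    obtain j where "X \<in> family (p j)" using X by (auto simp: concepts_def)
    then have "X \<in> family (p (max n j))" using fam[of j "max n j"] by auto
    with X show ?thesis by (intro exI[of _ "max n j"]) (auto simp: concepts_def)
  qed
  have eqv: "d i X = d i Y \<longleftrightarrow> eqv i X Y"
    if i: "i < length ms" and X: "X \<in> concepts ?F (ms ! i)" and Y: "Y \<in> concepts ?F (ms ! i)" for i X Y
  proof -
    obtain j where j: "X \<in> concepts (family (p j)) (ms ! i)" using conc[OF X] by blast
    obtain l where l: "j \<le> l" "Y \<in> concepts (family (p l)) (ms ! i)" using conc[OF Y] by blast
    have "X \<in> concepts (family (p l)) (ms ! i)" using j concepts_mono[OF fam[OF l(1)]] by blast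
    then show ?thesis using cond[of l] l(2) i d by (simp add: condition_def)
  qed
  have codes: "\<exists>j\<ge>n. c \<in> codes (p j)" if mem: "c \<in> codes (Cond ?F d A)" for c A n
  proof -
    obtain i X where *: "c = d i X" "i < length ms" "X \<in> concepts ?F (ms ! i)"
      using mem unfolding codes_def mem_Collect_eq cond.sel by blast
    obtain j where "n \<le> j" "X \<in> concepts (family (p j)) (ms ! i)" using conc[OF *(3)] by blast
    with * d codesI show ?thesis by metis
  qed
  have countable: "countable ?F" using cond by (simp add: condition_def)
  have closed: "section_closed ?F" using cond by (fastforce simp: section_closed_def condition_def)
  have empty: "{} \<in> ?F" using cond[of 0] by (auto simp: condition_def)
  \<comment> \<open>Reserves decrease, so \<open>a j\<close> lies in the reserve of stage
    \<open>n\<close> for all \<open>j \<ge> n\<close>, whereas the earlier ones have been removed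
    from it.\<close>
  have "condition (Cond ?F d (a ` {n..})) \<and> extends (Cond ?F d (a ` {n..})) (p n)" for n
  proof
    have "infinite (a ` {n..})"
      using inj infinite_Ici by (metis finite_image_iff inj_on_subset subset_UNIV)
    moreover have "codes (Cond ?F d (a ` {n..})) \<inter> a ` {n..} = {}"
      using codes a_codes by blast
    ultimately show "condition (Cond ?F d (a ` {n..}))"
      using countable closed empty eqv by (simp add: condition_def)
    have "a ` {n..} \<subseteq> reserve (p n)"
      using a mono unfolding extends_def by blast
    moreover have "codes (Cond ?F d (a ` {n..})) \<subseteq> codes (p n) \<union> reserve (p n)"
      using codes mono unfolding extends_def by blast
    ultimately show "extends (Cond ?F d (a ` {n..})) (p n)"
      unfolding extends_def using d by auto
  qed
  then show thesis using that by blast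
qed

text \<open>Sections of sections are sections, so closing under them after adding \<open>X\<close>
  brings in only countably many concepts. Half of the reserve suffices to code their new classes;
  the other half remains as reserve.\<close>

lemma extend_by_concept:
  assumes p: "condition p"
  obtains q where "condition q" "extends q p" "X \<in> family q"
proof -
  define G where "G = family p \<union> range (sec X)"
  have G: "countable G" "section_closed G" "{} \<in> G" "X \<in> G" "family p \<subseteq> G"
    using p by (auto simp: G_def condition_def section_closed_def sec_append intro: range_eqI[of _ _ "[]"])
  obtain h :: "nat \<Rightarrow> nat" where h: "inj h" "range h \<subseteq> reserve p"
    using p infinite_countable_subset[of "reserve p"] unfolding condition_def by blast
  \<comment> \<open>The enumeration \<open>h\<close> splits the reserve: even positions stay in it,
    odd positions provide codes through an enumeration of \<open>G\<close>.\<close>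
  define A where "A = h ` {n. even n}"
  define g where "g Y = h (2 * to_nat_on G Y + 1)" for Y
  have g: "g Y \<in> reserve p - A" for Y
    using h by (auto simp: g_def A_def inj_def) (metis even_mult_iff even_Suc dvd_triv_left)
  have g_inj: "inj_on g G"
  proof (rule inj_onI)
    fix Y Z assume YZ: "Y \<in> G" "Z \<in> G" "g Y = g Z"
    then have "to_nat_on G Y = to_nat_on G Z" using injD[OF h(1)] by (fastforce simp: g_def)
    with YZ show "Y = Z" using inj_on_to_nat_on[OF G(1)] by (simp add: inj_onD)
  qed
  \<comment> \<open>One representative per class; coding a new class by \<open>g\<close> of its
    representative makes the code depend on the class alone.\<close>
  define rep where "rep i Z = (SOME Y. Y \<in> concepts G (ms ! i) \<and> eqv i Z Y)" for i Z
  \<comment> \<open>A class that already meets the old family must keep its code, even when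
    \<open>Z\<close> itself is new.\<close>
  define d where "d i Z = (if \<exists>Y\<in>concepts (family p) (ms ! i). eqv i Z Y
      then code p i (SOME Y. Y \<in> concepts (family p) (ms ! i) \<and> eqv i Z Y) else g (rep i Z))" for i Z
  have UN: "Y \<in> concepts UNIV k" if "Y \<in> concepts H k" for Y H k
    using that by (simp add: concepts_def)
  have mem: "concepts (family p) k \<subseteq> concepts G k" for k
    using G(5) by (rule concepts_mono)
  have d_old: "d i Z = code p i Y"
    if i: "i < length ms" and Y: "Y \<in> concepts (family p) (ms ! i)" and Z: "Z \<in> concepts G (ms ! i)"
      and ZY: "eqv i Z Y" for i Z Y
  proof -
    let ?Y = "SOME Y. Y \<in> concepts (family p) (ms ! i) \<and> eqv i Z Y"
    have *: "?Y \<in> concepts (family p) (ms ! i) \<and> eqv i Z ?Y"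
      by (rule someI) (use Y ZY in blast)
    then have "eqv i ?Y Y"
      using eqv_trans[OF i, of ?Y Z Y] eqv_sym[OF i, of Z ?Y] i Y Z ZY UN by blast
    then have "code p i ?Y = code p i Y"
      using p i Y * by (simp add: condition_def)
    moreover have "\<exists>Y\<in>concepts (family p) (ms ! i). eqv i Z Y" using Y ZY by blast
    ultimately show ?thesis by (simp add: d_def)
  qed
  have rep: "rep i Z \<in> concepts G (ms ! i) \<and> eqv i Z (rep i Z)"
    if "i < length ms" "Z \<in> concepts G (ms ! i)" for i Z
    unfolding rep_def by (rule someI[of _ Z]) (use that eqv_refl UN in blast)
  have rep_cong: "rep i Z = rep i W"
    if i: "i < length ms" "Z \<in> concepts G (ms ! i)" "W \<in> concepts G (ms ! i)" "eqv i Z W" for i Z W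
  proof -
    \<comment> \<open>Equivalent concepts present \<open>SOME\<close> with the same predicate, hence
      receive the same representative.\<close>
    have "(Y \<in> concepts G (ms ! i) \<and> eqv i Z Y) = (Y \<in> concepts G (ms ! i) \<and> eqv i W Y)" for Y
      using that UN eqv_sym[OF i(1)] eqv_trans[OF i(1)] by meson
    then show ?thesis by (simp add: rep_def)
  qed
  have d_new: "d i Z = g (rep i Z)" if "\<not> (\<exists>Y\<in>concepts (family p) (ms ! i). eqv i Z Y)" for i Z
    using that by (simp add: d_def)
  have d_eqv: "d i Z = d i W \<longleftrightarrow> eqv i Z W"
    if i: "i < length ms" and Z: "Z \<in> concepts G (ms ! i)" and W: "W \<in> concepts G (ms ! i)" for i Z W
  proof -
    let ?old = "\<lambda>Z. \<exists>Y\<in>concepts (family p) (ms ! i). eqv i Z Y"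
    have sym: "eqv i Y X" if "eqv i X Y" "X \<in> concepts G (ms ! i)" "Y \<in> concepts G (ms ! i)" for X Y
      using that eqv_sym[OF i] UN by blast
    have trans: "eqv i X Z" if "eqv i X Y" "eqv i Y Z" "X \<in> concepts G (ms ! i)"
      "Y \<in> concepts G (ms ! i)" "Z \<in> concepts G (ms ! i)" for X Y Z
      using that eqv_trans[OF i] UN by blast
    \<comment> \<open>Old codes lie outside the reserve of \<open>p\<close>, new ones inside
      it.\<close>
    have new: "d i Z \<noteq> d i W"
      if old: "?old Z" "\<not> ?old W" and Z: "Z \<in> concepts G (ms ! i)" for Z W
    proof -
      obtain Y where Y: "Y \<in> concepts (family p) (ms ! i)" "eqv i Z Y" using old by blast
      have "d i Z = code p i Y" using d_old[OF i Y(1) Z Y(2)] .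
      moreover have "code p i Y \<notin> reserve p" using p codesI[OF i Y(1)] by (auto simp: condition_def)
      moreover have "d i W \<in> reserve p" using d_new[OF old(2)] g by simp
      ultimately show ?thesis by auto
    qed
    have tr: "?old W" if "?old Z" "eqv i Z W" "Z \<in> concepts G (ms ! i)" "W \<in> concepts G (ms ! i)" for Z W
      using that sym trans mem by blast
    consider "?old Z" "?old W" | "\<not> ?old Z" "\<not> ?old W" | "?old Z" "\<not> ?old W" | "\<not> ?old Z" "?old W"
      by blast
    then show ?thesis
    proof cases
      case 1
      then obtain Y V where Y: "Y \<in> concepts (family p) (ms ! i)" "eqv i Z Y"
        and V: "V \<in> concepts (family p) (ms ! i)" "eqv i W V" by blast
      have "d i Z = d i W \<longleftrightarrow> eqv i Y V"
        using d_old[OF i Y(1) Z Y(2)] d_old[OF i V(1) W V(2)] p i Y V by (simp add: condition_def)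
      also have "\<dots> \<longleftrightarrow> eqv i Z W"
      proof -
        have YV: "Y \<in> concepts G (ms ! i)" "V \<in> concepts G (ms ! i)" using Y V mem by blast+
        show ?thesis
        proof
          assume "eqv i Y V"
          from trans[OF trans[OF Y(2) this Z YV] sym[OF V(2) W YV(2)] Z YV(2) W] show "eqv i Z W" .
        next
          assume "eqv i Z W"
          from trans[OF trans[OF sym[OF Y(2) Z YV(1)] this YV(1) Z W] V(2) YV(1) W YV(2)]
          show "eqv i Y V" .
        qed
      qed
      finally show ?thesis .
    next
      case 2
      have "d i Z = d i W \<longleftrightarrow> rep i Z = rep i W"
        unfolding d_new[OF 2(1)] d_new[OF 2(2)]
        by (rule inj_on_eq_iff[OF g_inj]) (use rep[OF i Z] rep[OF i W] in \<open>simp_all add: concepts_def\<close>)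
      also have "\<dots> \<longleftrightarrow> eqv i Z W"
      proof
        assume eq: "rep i Z = rep i W"
        note Z' = rep[OF i Z, unfolded eq] and W' = rep[OF i W]
        show "eqv i Z W"
          by (rule trans[of Z "rep i W" W]) (use Z' W' Z W sym in simp_all)
      qed (rule rep_cong[OF i Z W])
      finally show ?thesis .
    next
      case 3
      then show ?thesis using new[of Z W] tr[of Z W] Z W by blast
    next
      case 4
      then show ?thesis using new[of W Z] tr[of W Z] sym[of Z W] Z W by metis
    qed
  qed
  have codes: "codes (Cond G d A) \<subseteq> codes p \<union> (reserve p - A)"
  proof
    fix c assume "c \<in> codes (Cond G d A)"
    then obtain i Z where c: "c = d i Z" "i < length ms" "Z \<in> concepts G (ms ! i)"
      by (auto simp: codes_def)
    show "c \<in> codes p \<union> (reserve p - A)"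
    proof (cases "\<exists>Y\<in>concepts (family p) (ms ! i). eqv i Z Y")
      case True
      then obtain Y where Y: "Y \<in> concepts (family p) (ms ! i)" "eqv i Z Y" by blast
      have "c = code p i Y" using d_old[OF c(2) Y(1) c(3) Y(2)] c(1) by simp
      then show ?thesis using codesI[OF c(2) Y(1)] by simp
    next
      case False
      then show ?thesis using d_new c g by auto
    qed
  qed
  have A: "A \<subseteq> reserve p" using h by (auto simp: A_def)
  have "infinite {n::nat. even n}"
    unfolding infinite_nat_iff_unbounded_le
    by (metis dvd_triv_left le_add1 mem_Collect_eq mult_2)
  then have "infinite A" unfolding A_def using h(1) by (metis finite_imageD inj_on_subset subset_UNIV)
  then have "condition (Cond G d A)"
    unfolding condition_def using G codes A p d_eqv by (auto simp: condition_def)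
  moreover have "extends (Cond G d A) p"
  proof -
    have "d i Y = code p i Y" if "i < length ms" "Y \<in> concepts (family p) (ms ! i)" for i Y
      using d_old[OF that, of Y] mem that eqv_refl UN by blast
    then show ?thesis unfolding extends_def using G(5) A codes by auto
  qed
  ultimately show thesis using that[of "Cond G d A"] G(4) by simp
qed

text \<open>A Rasiowa--Sikorski lemma; a task may have finitely many concepts of the family constructed
  so far as parameters. The limit is a condition below every stage, but with varying reserves.\<close>

lemma generic:
  assumes p0: "condition p0"
    and count: "\<And>K. finite K \<Longrightarrow> countable (tasks K)"
    and dense: "\<And>p K D. condition p \<Longrightarrow> extends p p0 \<Longrightarrow> finite K \<Longrightarrow> K \<subseteq> family p \<Longrightarrow> D \<in> tasks K \<Longrightarrow>
      \<exists>q. condition q \<and> extends q p \<and> D q"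
  obtains F d where "\<exists>A. condition (Cond F d A) \<and> extends (Cond F d A) p0"
    and "\<And>K D. finite K \<Longrightarrow> K \<subseteq> F \<Longrightarrow> D \<in> tasks K \<Longrightarrow>
      \<exists>q A. condition q \<and> K \<subseteq> family q \<and> D q \<and> condition (Cond F d A) \<and> extends (Cond F d A) q"
proof -
  \<comment> \<open>Each task is strengthened by \<open>K \<subseteq> family q\<close>, so that its
    parameters are present where it is met. The trivial task keeps the set nonempty, as its
    enumeration requires.\<close>
  define T where "T p = insert (\<lambda>_. True)
    (\<Union>K\<in>{K. finite K \<and> K \<subseteq> family p}. (\<lambda>D q. K \<subseteq> family q \<and> D q) ` tasks K)" for p
  have T_mono: "T p \<subseteq> T q" if "family p \<subseteq> family q" for p q
    using that by (auto simp: T_def)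
  have T_range: "range (from_nat_into (T p)) = T p" if "condition p" for p
  proof (rule range_from_nat_into)
    have "countable {K. finite K \<and> K \<subseteq> family p}"
      using that by (intro countable_Collect_finite_subset) (simp add: condition_def)
    then show "countable (T p)"
      unfolding T_def by (intro countable_insert countable_UN) (auto intro: count)
  qed (simp add: T_def)
  have T_dense: "\<exists>q. condition q \<and> extends q (shrink p) \<and> D q"
    if "condition p" "extends p p0" "D \<in> T p" for p D
  proof -
    have *: "condition (shrink p)" "extends (shrink p) p0"
      using that condition_shrink extends_shrink extends_trans by blast+
    from that(3) consider "D = (\<lambda>_. True)" | K D' where "finite K" "K \<subseteq> family p" "D' \<in> tasks K"
        "D = (\<lambda>q. K \<subseteq> family q \<and> D' q)"
      by (auto simp: T_def)
    then show ?thesis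
    proof cases
      case 1
      then show ?thesis using * extends_refl by blast
    next
      case 2
      then obtain q where "condition q" "extends q (shrink p)" "D' q"
        using dense[OF *, of K D'] by auto
      then show ?thesis using 2 by (auto simp: extends_def)
    qed
  qed
  \<comment> \<open>A state is a condition together with a table whose row \<open>j\<close>
    enumerates the tasks posed at stage \<open>j\<close>. Dependent choice sees only the current
    state, so the table carries the history.\<close>
  define P where "P n s = (condition (fst s) \<and> extends (fst s) p0 \<and> range (snd s n) = T (fst s) \<and>
      (\<forall>j\<le>n. range (snd s j) \<subseteq> T (fst s)))" for n :: nat and s :: "cond \<times> (nat \<Rightarrow> nat \<Rightarrow> cond \<Rightarrow> bool)"
  \<comment> \<open>Step \<open>n\<close> meets the task in the row and column coded by
    \<open>n\<close>. Every entry of the table has such a number, so no task is forgotten.\<close>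
  define Q where "Q n s s' = (extends (fst s') (shrink (fst s)) \<and> (\<forall>j\<le>n. snd s' j = snd s j) \<and>
      snd s (fst (prod_decode n)) (snd (prod_decode n)) (fst s'))"
    for n :: nat and s s' :: "cond \<times> (nat \<Rightarrow> nat \<Rightarrow> cond \<Rightarrow> bool)"
  have "\<exists>s. P 0 s"
    by (rule exI[of _ "(p0, \<lambda>_. from_nat_into (T p0))"])
      (use p0 T_range extends_refl in \<open>simp add: P_def\<close>)
  moreover have "\<exists>s'. P (Suc n) s' \<and> Q n s s'" if s: "P n s" for n s
  proof -
    let ?D = "snd s (fst (prod_decode n)) (snd (prod_decode n))"
    \<comment> \<open>The row called at step \<open>n\<close> has been filled by then.\<close>
    have "fst (prod_decode n) \<le> n"
      by (metis le_prod_encode_1 prod.collapse prod_decode_inverse)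
    then have "?D \<in> T (fst s)" using that unfolding P_def by blast
    then obtain q where q: "condition q" "extends q (shrink (fst s))" "?D q"
      using T_dense[of "fst s" ?D] s unfolding P_def by blast
    define E where "E = (snd s)(Suc n := from_nat_into (T q))"
    have "T (fst s) \<subseteq> T q" using q(2) by (intro T_mono) (simp add: extends_def)
    moreover have "extends q p0"
      using extends_trans[OF extends_trans[OF q(2) extends_shrink]] s by (simp add: P_def)
    ultimately have "P (Suc n) (q, E)"
      using q(1) s T_range[OF q(1)] by (force simp: P_def E_def le_Suc_eq)
    moreover have "Q n s (q, E)" using q by (simp add: Q_def E_def)
    ultimately show ?thesis by blast
  qed
  ultimately obtain f where f: "\<And>n. P n (f n)" "\<And>n. Q n (f n) (f (Suc n))"
    using dependent_nat_choice[of P Q] by metis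
  define p where "p n = fst (f n)" for n
  have cond: "condition (p n)" for n using f(1) by (simp add: P_def p_def)
  have ext: "extends (p (Suc n)) (shrink (p n))" for n using f(2) by (simp add: Q_def p_def)
  have E: "snd (f n) j = snd (f j) j" if "j \<le> n" for j n
    using that by (induction rule: dec_induct) (use f(2) in \<open>auto simp: Q_def\<close>)
  have "family (p n) \<subseteq> family (p (Suc n))" for n using ext[of n] by (simp add: extends_def)
  then have fam: "family (p n) \<subseteq> family (p j)" if "n \<le> j" for n j
    by (rule lift_Suc_mono_le[OF _ that])
  have met: "\<exists>j. D (p j)" if D: "D \<in> T (p n)" for D n
  proof -
    have "D \<in> range (snd (f n) n)" using f(1)[of n] D by (simp add: P_def p_def)
    then obtain b where b: "D = snd (f n) n b" by blast
    let ?j = "prod_encode (n, b)"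
    have "snd (f ?j) n b (p (Suc ?j))" using f(2)[of ?j] by (simp add: Q_def p_def)
    with b E[OF le_prod_encode_1] show ?thesis by metis
  qed
  obtain d where d: "\<And>n. \<exists>A. condition (Cond (\<Union>n. family (p n)) d A) \<and>
      extends (Cond (\<Union>n. family (p n)) d A) (p n)"
    by (rule fusion[of p, OF cond ext that])
  show thesis
  proof (rule that)
    show "\<exists>A. condition (Cond (\<Union>n. family (p n)) d A) \<and> extends (Cond (\<Union>n. family (p n)) d A) p0"
      using d[of 0] f(1)[of 0] extends_trans unfolding P_def p_def by blast
    fix K D assume K: "finite K" "K \<subseteq> (\<Union>n. family (p n))" "D \<in> tasks K"
    have "\<exists>n. K \<subseteq> family (p n)"
      using K(1,2)
    proof (induction K rule: finite_induct)
      case (insert X K)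
      then obtain n j where "K \<subseteq> family (p n)" "X \<in> family (p j)" by auto
      then have "insert X K \<subseteq> family (p (max n j))"
        using fam[of n "max n j"] fam[of j "max n j"] by auto
      then show ?case by blast
    qed simp
    then have "\<exists>n. (\<lambda>q. K \<subseteq> family q \<and> D q) \<in> T (p n)" using K unfolding T_def by blast
    then obtain j where "K \<subseteq> family (p j)" "D (p j)" using met by blast
    with d[of j] cond[of j]
    show "\<exists>q A. condition q \<and> K \<subseteq> family q \<and> D q \<and> condition (Cond (\<Union>n. family (p n)) d A) \<and>
        extends (Cond (\<Union>n. family (p n)) d A) q" by blast
  qed
qed

text \<open>\<open>P as X F d\<close> stands for \<open>X\<close> being a witness for the argument
  \<open>as\<close>. Besides fixing the arity of \<open>X\<close>, all that is asked of
  \<open>P\<close> is that it passes to extensions; this is where the restriction of choice to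
  Sigma^1_1 formulas matters.\<close>

lemma choice_dichotomy:
  assumes p: "condition p"
    and conc: "\<And>as X F d. P as X F d \<Longrightarrow> X \<in> concepts F m"
    and persist: "\<And>as X q r. P as X (family q) (code q) \<Longrightarrow> condition q \<Longrightarrow> condition r \<Longrightarrow>
      extends q p \<Longrightarrow> extends r q \<Longrightarrow> P as X (family r) (code r)"
  shows "\<exists>q. condition q \<and> extends q p \<and>
    ((\<exists>as. length as = n \<and> (\<forall>r X. condition r \<longrightarrow> extends r q \<longrightarrow> \<not> P as X (family r) (code r))) \<or>
     (\<exists>Z\<in>concepts (family q) (n + m). \<forall>as. length as = n \<longrightarrow> P as (sec Z as) (family q) (code q)))"
proof (rule ccontr)
  assume contra: "\<not> ?thesis"
  have dense: "\<exists>r. condition r \<and> extends r q \<and> (\<exists>X. P as X (family r) (code r))"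
    if "condition q" "extends q p" "length as = n" for q as
    using contra that by blast
  \<comment> \<open>One task per argument, independent of \<open>K\<close> since the parameters are
    hidden in \<open>P\<close>. Being below \<open>p\<close> is recorded in the task because
    \<open>persist\<close> asks for it at the stage where the witness appears.\<close>
  define tasks :: "concept set \<Rightarrow> (cond \<Rightarrow> bool) set" where
    "tasks K = (\<lambda>as q. extends q p \<and> (\<exists>X. P as X (family q) (code q))) ` {as. length as = n}" for K
  have tasks: "\<exists>r. condition r \<and> extends r q \<and> D r"
    if "condition q" "extends q p" "finite K" "K \<subseteq> family q" "D \<in> tasks K" for q K D
    using dense[OF that(1,2)] that extends_trans unfolding tasks_def by blast
  have count: "countable (tasks K)" if "finite K" for K unfolding tasks_def by simp
  obtain F d where F: "\<exists>A. condition (Cond F d A) \<and> extends (Cond F d A) p"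
    and met: "\<And>K D. finite K \<Longrightarrow> K \<subseteq> F \<Longrightarrow> D \<in> tasks K \<Longrightarrow>
      \<exists>q A. condition q \<and> K \<subseteq> family q \<and> D q \<and> condition (Cond F d A) \<and> extends (Cond F d A) q"
    by (rule generic[of p tasks, OF p count tasks that])
  have "\<exists>X. P as X F d" if as: "length as = n" for as
  proof -
    have "(\<lambda>q. extends q p \<and> (\<exists>X. P as X (family q) (code q))) \<in> tasks {}"
      using as by (simp add: tasks_def)
    then obtain q A X where q: "condition q" "extends q p" "P as X (family q) (code q)"
      "condition (Cond F d A)" "extends (Cond F d A) q"
      using met[of "{}"] by blast
    from persist[OF q(3,1,4,2,5)] show ?thesis by auto
  qed
  then obtain X where X: "\<And>as. length as = n \<Longrightarrow> P as (X as) F d" by metis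
  obtain A where A: "condition (Cond F d A)" "extends (Cond F d A) p" using F by blast
  \<comment> \<open>All witnesses glued into one concept; since the first parts have length
    \<open>n\<close>, the section at \<open>as\<close> returns exactly \<open>X as\<close>.\<close>
  define Z where "Z = {as @ bs | as bs. length as = n \<and> bs \<in> X as}"
  have sec: "sec Z as = X as" if "length as = n" for as
    using that by (auto simp: Z_def sec_def)
  \<comment> \<open>Here the limit has to be a condition: it must still have codes to spare for
    \<open>Z\<close> and its sections.\<close>
  obtain q where q: "condition q" "extends q (Cond F d A)" "Z \<in> family q"
    using extend_by_concept[OF A(1)] by blast
  have "P as (sec Z as) (family q) (code q)" if "length as = n" for as
    using persist[of as "X as" "Cond F d A" q, OF _ A(1) q(1) A(2) q(2)] X[OF that]
    unfolding sec[OF that] cond.sel by blast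
  moreover have "length cs = n + m" if "cs \<in> Z" for cs
  proof -
    obtain as bs where cs: "cs = as @ bs" "length as = n" "bs \<in> X as"
      using \<open>cs \<in> Z\<close> unfolding Z_def by blast
    then have "length bs = m" using conc[OF X[OF cs(2)]] by (simp add: concepts_def)
    with cs show ?thesis by simp
  qed
  then have "Z \<in> concepts (family q) (n + m)" using q(3) by (simp add: concepts_def)
  ultimately show False using contra q(1) extends_trans[OF q(2) A(2)] by blast
qed

end

section \<open>The generic model\<close>

instance sort :: countable by countable_datatype
instance tm :: countable by countable_datatype
instance fm :: countable by countable_datatype

text \<open>A formula sees only finitely many values of an assignment. Finite lists of bindings keep
  the number of tasks countable, which total assignments would not.\<close>

definition env :: "(var \<times> val) list \<Rightarrow> var \<Rightarrow> val" where
  "env l x = (case map_of l x of None \<Rightarrow> if fst x = Ob then Num 0 else Con {} | Some v \<Rightarrow> v)"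

definition bindings :: "concept set \<Rightarrow> (var \<times> val) list set" where
  "bindings K = {l. \<forall>(x, v)\<in>set l. v \<in> range_of K (fst x)}"

lemma countable_bindings:
  assumes "countable K"
  shows "countable (bindings K)"
proof (rule countable_subset)
  show "bindings K \<subseteq> lists (UNIV \<times> (range Num \<union> Con ` K))"
  proof
    fix l assume l: "l \<in> bindings K"
    have "v \<in> range Num \<union> Con ` K" if "(x, v) \<in> set l" for x v
    proof -
      have "v \<in> range_of K (fst x)" using l that unfolding bindings_def by blast
      then show ?thesis by (cases "fst x") (auto simp: concepts_def)
    qed
    then show "l \<in> lists (UNIV \<times> (range Num \<union> Con ` K))" by auto
  qed
  show "countable (lists ((UNIV :: var set) \<times> (range Num \<union> Con ` K)))"
    using assms by auto
qed

lemma assignment_env: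
  assumes "l \<in> bindings K" "K \<subseteq> F" "{} \<in> F"
  shows "assignment F (env l)"
  unfolding assignment_def
proof
  fix x
  show "env l x \<in> range_of F (fst x)"
  proof (cases "map_of l x")
    case None
    then show ?thesis
      using assignment_default[OF assms(3)] by (auto simp: env_def assignment_def)
  next
    case (Some v)
    then have "v \<in> range_of K (fst x)"
      using assms(1) by (auto simp: bindings_def dest: map_of_SomeD)
    then show ?thesis using Some range_of_mono[OF assms(2)] by (auto simp: env_def)
  qed
qed

lemma env_approximates:
  assumes "assignment F e" "finite V"
  obtains K l where "finite K" "K \<subseteq> F" "l \<in> bindings K" "\<And>x. x \<in> V \<Longrightarrow> env l x = e x"
proof -
  obtain vs where vs: "set vs = V" using assms(2) finite_list by blast
  define l where "l = map (\<lambda>x. (x, e x)) vs"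
  \<comment> \<open>The parameters of the task: the concepts that \<open>e\<close> assigns to
    variables in \<open>V\<close>.\<close>
  define K where "K = {X \<in> F. Con X \<in> e ` V}"
  have "finite (the_con ` e ` V)" using assms(2) by simp
  then have "finite K" by (rule rev_finite_subset) (metis (lifting) K_def image_eqI mem_Collect_eq subsetI val.sel(2))
  moreover have "l \<in> bindings K"
  proof -
    have "e x \<in> range_of K (fst x)" if "x \<in> V" for x
      using assms(1)[unfolded assignment_def, rule_format, of x] that
      by (cases "fst x") (auto simp: K_def concepts_def image_iff intro!: bexI[of _ x])
    then show ?thesis by (auto simp: bindings_def l_def vs)
  qed
  moreover have "env l x = e x" if "x \<in> V" for x
    using that by (simp add: env_def l_def vs map_of_map_restrict)
  moreover have "K \<subseteq> F" by (auto simp: K_def)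
  ultimately show thesis using that by blast
qed

text \<open>An instance of the Tarski--Vaught test. Truth is taken among all concepts and does not
  depend on the condition, so a task once met remains met.\<close>

definition witness_task :: "fm \<Rightarrow> (var \<times> val) list \<Rightarrow> var \<Rightarrow> cond \<Rightarrow> bool" where
  "witness_task \<phi> l x q \<longleftrightarrow>
    ((\<exists>v\<in>range_of UNIV (fst x). sat UNIV (\<lambda>_ _. 0) ((env l)(x := v)) \<phi>) \<longrightarrow>
     (\<exists>v\<in>range_of (family q) (fst x). sat UNIV (\<lambda>_ _. 0) ((env l)(x := v)) \<phi>))"

text \<open>The extension is computed in \<open>q\<close> itself; absoluteness makes it the
  extension in the limit as well.\<close>

definition comprehension_task :: "fm \<Rightarrow> (var \<times> val) list \<Rightarrow> var list \<Rightarrow> cond \<Rightarrow> bool" where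
  "comprehension_task \<phi> l xs q \<longleftrightarrow> extension (family q) (code q) (env l) xs \<phi> \<in> family q"

text \<open>The pair \<open>(m, j)\<close> names the variable \<open>(Cn m, j)\<close>, which is the
  variable \<open>R'\<close> of choice, and exposes its arity. The order of the arguments fits
  \<open>P\<close> in \<open>choice_dichotomy\<close>.\<close>

definition instance_at :: "(var \<Rightarrow> val) \<Rightarrow> fm \<Rightarrow> var list \<Rightarrow> nat \<times> nat \<Rightarrow> nat list \<Rightarrow> concept \<Rightarrow>
    concept set \<Rightarrow> (nat \<Rightarrow> concept \<Rightarrow> nat) \<Rightarrow> bool" where
  "instance_at e \<phi> xs = (\<lambda>(m, j) as X F d.
     X \<in> concepts F m \<and> sat F d ((upds e xs as)((Cn m, j) := Con X)) \<phi>)"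

lemma instance_at_mono:
  assumes "section_closed F" "F \<subseteq> G" "assignment F e" "\<forall>x\<in>set xs. fst x = Ob"
    and "\<And>i X. i < length ms \<Longrightarrow> X \<in> concepts F (ms ! i) \<Longrightarrow> d i X = d' i X"
    and "sigma11 \<phi>" "wff ms \<phi>" "instance_at e \<phi> xs mj as X F d"
  shows "instance_at e \<phi> xs mj as X G d'"
proof -
  obtain m j where [simp]: "mj = (m, j)" by (cases mj)
  have X: "X \<in> concepts F m" "sat F d ((upds e xs as)((Cn m, j) := Con X)) \<phi>"
    using assms(8) by (auto simp: instance_at_def)
  have "assignment F ((upds e xs as)((Cn m, j) := Con X))"
    using assms(3,4) X(1) by (intro assignment_upd assignment_upds) auto
  from sat_sigma11_mono[OF assms(1,2), of ms d d', OF assms(5) assms(6,7) this X(2)] X(1)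
  show ?thesis using concepts_mono[OF assms(2)] by (auto simp: instance_at_def)
qed

section \<open>Tasks, their density, and the model meeting them\<close>

context forcing
begin

definition choice_task :: "fm \<Rightarrow> (var \<times> val) list \<Rightarrow> var list \<Rightarrow> nat \<times> nat \<Rightarrow> cond \<Rightarrow> bool" where
  "choice_task \<phi> l xs mj q \<longleftrightarrow>
    (\<exists>as. length as = length xs \<and> (\<forall>r X. condition r \<longrightarrow> extends r q \<longrightarrow>
       \<not> instance_at (env l) \<phi> xs mj as X (family r) (code r))) \<or>
    (\<exists>Z\<in>concepts (family q) (length xs + fst mj). \<forall>as. length as = length xs \<longrightarrow>
       instance_at (env l) \<phi> xs mj as (sec Z as) (family q) (code q))"

definition tasks :: "concept set \<Rightarrow> (cond \<Rightarrow> bool) set" where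
  "tasks K =
     {witness_task \<phi> l x | \<phi> l x. l \<in> bindings K} \<union>
     {comprehension_task \<phi> l xs | \<phi> l xs. l \<in> bindings K \<and> wff ms \<phi> \<and> first_order \<phi> \<and>
        (\<forall>x\<in>set xs. fst x = Ob)} \<union>
     {choice_task \<phi> l xs mj | \<phi> l xs mj. l \<in> bindings K \<and> wff ms \<phi> \<and> sigma11 \<phi> \<and>
        (\<forall>x\<in>set xs. fst x = Ob)}"

lemma countable_tasks:
  assumes "finite K"
  shows "countable (tasks K)"
proof (rule countable_subset)
  let ?B = "bindings K"
  show "tasks K \<subseteq> (\<lambda>(\<phi>, l, x). witness_task \<phi> l x) ` (UNIV \<times> ?B \<times> UNIV) \<union>
     (\<lambda>(\<phi>, l, xs). comprehension_task \<phi> l xs) ` (UNIV \<times> ?B \<times> UNIV) \<union>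
     (\<lambda>(\<phi>, l, xs, mj). choice_task \<phi> l xs mj) ` (UNIV \<times> ?B \<times> UNIV \<times> UNIV)" (is "_ \<subseteq> ?T")
    unfolding tasks_def by (auto simp: image_iff) blast+
  show "countable ?T"
    using countable_bindings[OF countable_finite[OF assms]]
    by (intro countable_Un countable_image countable_SIGMA) auto
qed

lemma extends_code:
  "extends q p \<Longrightarrow> i < length ms \<Longrightarrow> X \<in> concepts (family p) (ms ! i) \<Longrightarrow> code p i X = code q i X"
  by (simp add: extends_def)

lemma sat_extends:
  assumes "condition p" "extends q p" "wff ms \<phi>" "first_order \<phi>" "assignment (family p) e"
  shows "sat (family p) (code p) e \<phi> = sat (family q) (code q) e \<phi>"
proof (rule sat_first_order_agree[where ms = ms])
  show "section_closed (family p)" using assms(1) by (simp add: condition_def)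
qed (use assms extends_code in auto)

lemma extension_extends:
  assumes "condition p" "extends q p" "wff ms \<phi>" "first_order \<phi>" "assignment (family p) e"
    and "\<forall>x\<in>set xs. fst x = Ob"
  shows "extension (family p) (code p) e xs \<phi> = extension (family q) (code q) e xs \<phi>"
  unfolding extension_def
  using sat_extends[OF assms(1-4) assignment_upds[OF assms(5,6)]] by simp

lemma instance_at_extends:
  assumes "condition p" "extends q p" "wff ms \<phi>" "sigma11 \<phi>" "assignment (family p) e"
    and "\<forall>x\<in>set xs. fst x = Ob" "instance_at e \<phi> xs mj as X (family p) (code p)"
  shows "instance_at e \<phi> xs mj as X (family q) (code q)"
proof (rule instance_at_mono[where ms = ms])
  show "section_closed (family p)" using assms(1) by (simp add: condition_def)
  show "family p \<subseteq> family q" using assms(2) by (simp add: extends_def)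
qed (use assms extends_code in auto)

lemma assignment_extends:
  "extends q p \<Longrightarrow> assignment (family p) e \<Longrightarrow> assignment (family q) e"
  by (rule assignment_mono) (auto simp: extends_def)

lemma tasks_dense:
  assumes p: "condition p" and K: "K \<subseteq> family p" and D: "D \<in> tasks K"
  shows "\<exists>q. condition q \<and> extends q p \<and> D q"
proof -
  have env: "assignment (family p) (env l)" if "l \<in> bindings K" for l
    using assignment_env[OF that K] p by (simp add: condition_def)
  consider (witness) \<phi> l x where "D = witness_task \<phi> l x"
    | (comprehension) \<phi> l xs where "D = comprehension_task \<phi> l xs" "wff ms \<phi>" "first_order \<phi>"
        "l \<in> bindings K" "\<forall>x\<in>set xs. fst x = Ob"
    | (choice) \<phi> l xs mj where "D = choice_task \<phi> l xs mj" "wff ms \<phi>" "sigma11 \<phi>"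
        "l \<in> bindings K" "\<forall>x\<in>set xs. fst x = Ob"
    using D unfolding tasks_def by blast
  then show ?thesis
  proof cases
    case witness
    show ?thesis
    proof (cases "\<exists>v\<in>range_of UNIV (fst x). sat UNIV (\<lambda>_ _. 0) ((env l)(x := v)) \<phi>")
      case True
      then obtain v where v: "v \<in> range_of UNIV (fst x)" "sat UNIV (\<lambda>_ _. 0) ((env l)(x := v)) \<phi>"
        by blast
      \<comment> \<open>For an object variable \<open>the_con v\<close> is unspecified and adding it
        is harmless, as all numbers are in range anyway.\<close>
      obtain q where q: "condition q" "extends q p" "the_con v \<in> family q"
        using extend_by_concept[OF p] by blast
      have "v \<in> range_of (family q) (fst x)"
        using v(1) q(3) by (cases "fst x") (auto simp: concepts_def)
      then show ?thesis using q v witness by (auto simp: witness_task_def)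
    next
      case False
      then show ?thesis using p extends_refl witness by (auto simp: witness_task_def)
    qed
  next
    case comprehension
    \<comment> \<open>The set is defined over \<open>p\<close>; absoluteness makes it also the
      extension over the larger \<open>q\<close> that contains it.\<close>
    obtain q where q: "condition q" "extends q p"
      "extension (family p) (code p) (env l) xs \<phi> \<in> family q"
      using extend_by_concept[OF p] by blast
    then show ?thesis
      using extension_extends[OF p q(2) comprehension(2,3) env[OF comprehension(4)] comprehension(5)]
      by (auto simp: comprehension_task_def comprehension(1))
  next
    case choice
    show ?thesis
      unfolding choice(1) choice_task_def
    proof (rule choice_dichotomy[OF p])
      fix as X F d assume "instance_at (env l) \<phi> xs mj as X F d"
      then show "X \<in> concepts F (fst mj)"
        unfolding instance_at_def by (auto split: prod.splits)
    next
      fix as X q r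
      assume "instance_at (env l) \<phi> xs mj as X (family q) (code q)" "condition q" "condition r"
        "extends q p" "extends r q"
      then show "instance_at (env l) \<phi> xs mj as X (family r) (code r)"
        using instance_at_extends choice(2,3,5) assignment_extends env[OF choice(4)] by blast
    qed
  qed
qed

text \<open>Each of the last three properties concerns arbitrary assignments;
  \<open>env_approximates\<close> turns it into a single task with a finite set of parameters from
  \<open>F\<close>.\<close>

lemma generic_model:
  obtains F d where "section_closed F" "{} \<in> F"
    and "\<And>i X Y. i < length ms \<Longrightarrow> X \<in> concepts F (ms ! i) \<Longrightarrow> Y \<in> concepts F (ms ! i) \<Longrightarrow>
      d i X = d i Y \<longleftrightarrow> eqv i X Y"
    and "\<And>\<phi> x e v. assignment F e \<Longrightarrow> v \<in> range_of UNIV (fst x) \<Longrightarrow>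
      sat UNIV (\<lambda>_ _. 0) (e(x := v)) \<phi> \<Longrightarrow> \<exists>w\<in>range_of F (fst x). sat UNIV (\<lambda>_ _. 0) (e(x := w)) \<phi>"
    and "\<And>\<phi> e xs. wff ms \<phi> \<Longrightarrow> first_order \<phi> \<Longrightarrow> assignment F e \<Longrightarrow> \<forall>x\<in>set xs. fst x = Ob \<Longrightarrow>
      extension F d e xs \<phi> \<in> F"
    and "\<And>\<phi> e xs m j. wff ms \<phi> \<Longrightarrow> sigma11 \<phi> \<Longrightarrow> assignment F e \<Longrightarrow> \<forall>x\<in>set xs. fst x = Ob \<Longrightarrow>
      \<forall>as. length as = length xs \<longrightarrow> (\<exists>X. instance_at e \<phi> xs (m, j) as X F d) \<Longrightarrow>
      \<exists>Z\<in>concepts F (length xs + m). \<forall>as. length as = length xs \<longrightarrow>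
        instance_at e \<phi> xs (m, j) as (sec Z as) F d"
proof -
  \<comment> \<open>The empty set has every arity, so it needs a code for every operator from the
    start; 0 serves, and the positive numbers form the reserve.\<close>
  define p0 where "p0 = Cond {{}} (\<lambda>_ _. 0) {0<..}"
  have "condition p0"
    using eqv_refl by (auto simp: p0_def condition_def codes_def section_closed_def sec_def
        concepts_def infinite_Ioi)
  then obtain F d A where A: "condition (Cond F d A)"
    and met: "\<And>K D. finite K \<Longrightarrow> K \<subseteq> F \<Longrightarrow> D \<in> tasks K \<Longrightarrow>
      \<exists>q A. condition q \<and> K \<subseteq> family q \<and> D q \<and> condition (Cond F d A) \<and> extends (Cond F d A) q"
  proof (rule generic[of p0 tasks])
    show "\<exists>q. condition q \<and> extends q p \<and> D q"
      if "condition p" "extends p p0" "finite K" "K \<subseteq> family p" "D \<in> tasks K" for p K D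
      using that by (intro tasks_dense)
  qed (use countable_tasks in blast)+
  show thesis
  proof (rule that)
    show "section_closed F" "{} \<in> F" using A by (simp_all add: condition_def)
    show "d i X = d i Y \<longleftrightarrow> eqv i X Y"
      if "i < length ms" "X \<in> concepts F (ms ! i)" "Y \<in> concepts F (ms ! i)" for i X Y
      using A that by (simp add: condition_def)
  next
    fix \<phi> x e v
    assume e: "assignment F e" and v: "v \<in> range_of UNIV (fst x)" "sat UNIV (\<lambda>_ _. 0) (e(x := v)) \<phi>"
    obtain K l where K: "finite K" "K \<subseteq> F" "l \<in> bindings K" "\<And>x. x \<in> fv \<phi> \<Longrightarrow> env l x = e x"
      using env_approximates[OF e finite_fv] by metis
    have cong: "sat UNIV (\<lambda>_ _. 0) ((env l)(x := v)) \<phi> = sat UNIV (\<lambda>_ _. 0) (e(x := v)) \<phi>" for v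
      by (rule sat_cong) (use K(4) in auto)
    have "witness_task \<phi> l x \<in> tasks K" unfolding tasks_def using K(3) by blast
    then obtain q A where q: "witness_task \<phi> l x q" "extends (Cond F d A) q"
      using met[OF K(1,2)] by blast
    then have "\<exists>w\<in>range_of (family q) (fst x). sat UNIV (\<lambda>_ _. 0) (e(x := w)) \<phi>"
      using v unfolding witness_task_def cong by blast
    moreover have "family q \<subseteq> F" using q(2) by (simp add: extends_def)
    ultimately show "\<exists>w\<in>range_of F (fst x). sat UNIV (\<lambda>_ _. 0) (e(x := w)) \<phi>"
      using range_of_mono by blast
  next
    fix \<phi> e and xs :: "var list"
    assume \<phi>: "wff ms \<phi>" "first_order \<phi>" and e: "assignment F e" and xs: "\<forall>x\<in>set xs. fst x = Ob"
    obtain K l where K: "finite K" "K \<subseteq> F" "l \<in> bindings K" "\<And>x. x \<in> fv \<phi> \<Longrightarrow> env l x = e x"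
      using env_approximates[OF e finite_fv] by metis
    have "sat F d (upds (env l) xs as) \<phi> = sat F d (upds e xs as) \<phi>" for as
      by (intro sat_cong upds_cong K(4))
    then have cong: "extension F d (env l) xs \<phi> = extension F d e xs \<phi>"
      by (simp add: extension_def)
    have "comprehension_task \<phi> l xs \<in> tasks K"
      unfolding tasks_def using K(3) \<phi> xs by blast
    then obtain q A where q: "condition q" "K \<subseteq> family q" "comprehension_task \<phi> l xs q"
      "extends (Cond F d A) q"
      using met[OF K(1,2)] by blast
    have "assignment (family q) (env l)"
      using assignment_env[OF K(3) q(2)] q(1) by (simp add: condition_def)
    from extension_extends[OF q(1,4) \<phi> this xs] have "extension F d e xs \<phi> \<in> family q"
      using q(3) by (simp add: comprehension_task_def cong)
    then show "extension F d e xs \<phi> \<in> F" using q(4) by (auto simp: extends_def)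
  next
    fix \<phi> e m j and xs :: "var list"
    assume \<phi>: "wff ms \<phi>" "sigma11 \<phi>" and e: "assignment F e" and xs: "\<forall>x\<in>set xs. fst x = Ob"
      and all: "\<forall>as. length as = length xs \<longrightarrow> (\<exists>X. instance_at e \<phi> xs (m, j) as X F d)"
    show "\<exists>Z\<in>concepts F (length xs + m). \<forall>as. length as = length xs \<longrightarrow>
        instance_at e \<phi> xs (m, j) as (sec Z as) F d"
    proof -
      obtain K l where K: "finite K" "K \<subseteq> F" "l \<in> bindings K" "\<And>x. x \<in> fv \<phi> \<Longrightarrow> env l x = e x"
        using env_approximates[OF e finite_fv] by metis
      have "sat F d ((upds (env l) xs as)((Cn m, j) := Con X)) \<phi> =
          sat F d ((upds e xs as)((Cn m, j) := Con X)) \<phi>" for as X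
        by (rule sat_cong) (simp add: upds_cong[OF K(4)])
      then have cong: "instance_at (env l) \<phi> xs (m, j) as X F d = instance_at e \<phi> xs (m, j) as X F d"
        for as X by (simp add: instance_at_def)
      have "choice_task \<phi> l xs (m, j) \<in> tasks K"
        unfolding tasks_def using K(3) \<phi> xs by blast
      then obtain q A where q: "condition q" "K \<subseteq> family q" "choice_task \<phi> l xs (m, j) q"
        "condition (Cond F d A)" "extends (Cond F d A) q"
        using met[OF K(1,2)] by blast
      have env: "assignment (family q) (env l)"
        using assignment_env[OF K(3) q(2)] q(1) by (simp add: condition_def)
      have "\<exists>X. instance_at (env l) \<phi> xs (m, j) as X F d" if "length as = length xs" for as
        using all that by (simp add: cong)
      \<comment> \<open>The limit is itself a condition extending \<open>q\<close>, and it has a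
        witness for each argument; this rules out the first alternative of the task.\<close>
      then have "\<not> (\<exists>as. length as = length xs \<and> (\<forall>r X. condition r \<longrightarrow> extends r q \<longrightarrow>
          \<not> instance_at (env l) \<phi> xs (m, j) as X (family r) (code r)))"
        using q(4,5) cond.sel(1,2)[of F d A] by metis
      then obtain Z where Z: "Z \<in> concepts (family q) (length xs + m)"
        "\<And>as. length as = length xs \<Longrightarrow>
          instance_at (env l) \<phi> xs (m, j) as (sec Z as) (family q) (code q)"
        by (meson q(3)[unfolded choice_task_def fst_conv])
      have "Z \<in> concepts F (length xs + m)"
        using Z(1) q(5) concepts_mono[of "family q" F] by (auto simp: extends_def)
      moreover have "instance_at e \<phi> xs (m, j) as (sec Z as) F d" if "length as = length xs" for as
        using instance_at_extends[OF q(1,5) \<phi> env xs Z(2)[OF that]] by (simp add: cong)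
      ultimately show ?thesis by blast
    qed
  qed
qed

end

section \<open>Consistency\<close>

text \<open>The values off \<open>R\<close> and \<open>S\<close> are mere fillers, even ill-sorted
  at concept variables; the formulas in question have only \<open>R\<close> and \<open>S\<close>
  free.\<close>

definition relation_of :: "var \<Rightarrow> var \<Rightarrow> fm \<Rightarrow> concept \<Rightarrow> concept \<Rightarrow> bool" where
  "relation_of R S E X Y \<longleftrightarrow>
     sat UNIV (\<lambda>_ _. 0) ((\<lambda>_. Num 0)(R := Con X, S := Con Y)) E"

lemma relation_of_iff:
  assumes "fv E = {R, S}" "e R = Con X" "e S = Con Y" "R \<noteq> S"
  shows "sat UNIV (\<lambda>_ _. 0) e E \<longleftrightarrow> relation_of R S E X Y"
  unfolding relation_of_def by (rule sat_cong) (use assms in auto)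

lemma relation_of_equivalence:
  assumes fv: "fv E = {R, S}" and RS: "R \<noteq> S" and valid: "valid UNIV (\<lambda>_ _. 0) (equivalence m R S E)"
  shows "X \<in> concepts UNIV m \<Longrightarrow> relation_of R S E X X"
    and "X \<in> concepts UNIV m \<Longrightarrow> Y \<in> concepts UNIV m \<Longrightarrow>
      relation_of R S E X Y \<Longrightarrow> relation_of R S E Y X"
    and "X \<in> concepts UNIV m \<Longrightarrow> Y \<in> concepts UNIV m \<Longrightarrow> Z \<in> concepts UNIV m \<Longrightarrow>
      relation_of R S E X Y \<Longrightarrow> relation_of R S E Y Z \<Longrightarrow> relation_of R S E X Z"
proof -
  let ?E = "\<lambda>P Q. subst (Var(R := Var P, S := Var Q)) E"
  have E: "sat UNIV (\<lambda>_ _. 0) e (?E P Q) \<longleftrightarrow> relation_of R S E (the_con (e P)) (the_con (e Q))"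
    if PQ: "e P \<in> range_of UNIV (Cn m)" "e Q \<in> range_of UNIV (Cn m)" for e P Q
  proof -
    obtain X Y where "e P = Con X" "e Q = Con Y" using PQ by auto
    then show ?thesis
      unfolding sat_subst using relation_of_iff[OF fv _ _ RS] RS by simp
  qed
  obtain e :: "var \<Rightarrow> val" where "assignment UNIV e" using assignment_default[of UNIV] by blast
  then have sat: "sat UNIV (\<lambda>_ _. 0) e (equivalence m R S E)" using valid by (simp add: valid_def)
  have "sat UNIV (\<lambda>_ _. 0) e (equivalence m R S E) \<longleftrightarrow>
      (\<forall>X\<in>concepts UNIV m. relation_of R S E X X) \<and>
      (\<forall>X\<in>concepts UNIV m. \<forall>Y\<in>concepts UNIV m. relation_of R S E X Y \<longrightarrow> relation_of R S E Y X) \<and>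
      (\<forall>X\<in>concepts UNIV m. \<forall>Y\<in>concepts UNIV m. \<forall>Z\<in>concepts UNIV m.
        relation_of R S E X Y \<longrightarrow> relation_of R S E Y Z \<longrightarrow> relation_of R S E X Z)"
    by (simp add: equivalence_def Let_def E)
  with sat have refl: "\<forall>X\<in>concepts UNIV m. relation_of R S E X X"
    and sym: "\<forall>X\<in>concepts UNIV m. \<forall>Y\<in>concepts UNIV m.
      relation_of R S E X Y \<longrightarrow> relation_of R S E Y X"
    and trans: "\<forall>X\<in>concepts UNIV m. \<forall>Y\<in>concepts UNIV m. \<forall>Z\<in>concepts UNIV m.
      relation_of R S E X Y \<longrightarrow> relation_of R S E Y Z \<longrightarrow> relation_of R S E X Z"
    by blast+
  show "X \<in> concepts UNIV m \<Longrightarrow> relation_of R S E X X" using refl by blast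
  show "X \<in> concepts UNIV m \<Longrightarrow> Y \<in> concepts UNIV m \<Longrightarrow>
      relation_of R S E X Y \<Longrightarrow> relation_of R S E Y X" using sym by blast
  show "X \<in> concepts UNIV m \<Longrightarrow> Y \<in> concepts UNIV m \<Longrightarrow> Z \<in> concepts UNIV m \<Longrightarrow>
      relation_of R S E X Y \<Longrightarrow> relation_of R S E Y Z \<Longrightarrow> relation_of R S E X Z" using trans by blast
qed

section \<open>Validity of abstraction and choice, and the conclusion\<close>

lemma has_sort_Var: "fst x = s \<Longrightarrow> s \<noteq> Cn 0 \<Longrightarrow> has_sort ms (Var x) s"
  by (cases x) (auto intro: has_sort.intros)

lemma wff_Foralls: "wff ms (Foralls xs \<phi>) \<longleftrightarrow> (\<forall>x\<in>set xs. fst x \<noteq> Cn 0) \<and> wff ms \<phi>"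
  by (induction xs) auto

text \<open>Two facts meet here: codes agree exactly on classes of the relation in the standard
  model, and by elementarity \<open>E\<close> defines that same relation within
  \<open>F\<close>.\<close>

lemma valid_abstraction:
  assumes "\<And>X Y. X \<in> concepts F m \<Longrightarrow> Y \<in> concepts F m \<Longrightarrow> d i X = d i Y \<longleftrightarrow> relation_of R S E X Y"
    and "\<And>e. assignment F e \<Longrightarrow> sat F d e E \<longleftrightarrow> sat UNIV (\<lambda>_ _. 0) e E"
    and "fv E = {R, S}" "R \<noteq> S" "fst R = Cn m" "fst S = Cn m"
  shows "valid F d (abstraction i R S E)"
proof -
  have "sat F d (e(R := Con X, S := Con Y)) E \<longleftrightarrow> d i X = d i Y"
    if "assignment F e" "X \<in> concepts F m" "Y \<in> concepts F m" for e X Y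
  proof -
    have "assignment F (e(R := Con X, S := Con Y))"
      using that assms(5,6) by (intro assignment_upd) auto
    then show ?thesis
      using assms(1)[OF that(2,3)] assms(2) relation_of_iff[OF assms(3) _ _ assms(4)] assms(4) by simp
  qed
  then show ?thesis using assms(4-6) by (auto simp: valid_def abstraction_def)
qed

lemma valid_choice:
  assumes ch: "\<And>\<phi> e xs m j. \<phi> \<in> \<Phi> \<Longrightarrow> assignment F e \<Longrightarrow> \<forall>x\<in>set xs. fst x = Ob \<Longrightarrow>
      \<forall>as. length as = length xs \<longrightarrow> (\<exists>X. instance_at e \<phi> xs (m, j) as X F d) \<Longrightarrow>
      \<exists>Z\<in>concepts F (length xs + m). \<forall>as. length as = length xs \<longrightarrow>
        instance_at e \<phi> xs (m, j) as (sec Z as) F d"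
    and "\<psi> \<in> choice \<Phi>"
  shows "valid F d \<psi>"
proof -
  obtain R R' xs n m \<phi> where \<psi>: "\<psi> = Imp (Foralls xs (Exists R' \<phi>))
         (Exists R (Foralls xs (subst1 \<phi> R' (Sec (Var R) (map Var xs)))))"
    and \<phi>: "\<phi> \<in> \<Phi>" and nm: "n \<ge> 1" "m \<ge> 1" "fst R = Cn (n + m)" "fst R' = Cn m"
    and ov: "obj_vars n xs" and R: "R \<notin> fv \<phi>"
    using assms(2) unfolding choice_def by blast
  obtain j where R': "R' = (Cn m, j)" using nm(4) by (cases R') auto
  have xs: "\<forall>x\<in>set xs. fst x = Ob" "length xs = n" using ov by (auto simp: obj_vars_def)
  have Rxs: "R \<notin> set xs" using xs nm by auto
  have "sat F d e (Exists R (Foralls xs (subst1 \<phi> R' (Sec (Var R) (map Var xs)))))"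
    if e: "assignment F e" and all: "sat F d e (Foralls xs (Exists R' \<phi>))" for e
  proof -
    have "\<forall>as. length as = length xs \<longrightarrow> (\<exists>X. instance_at e \<phi> xs (m, j) as X F d)"
      using all by (auto simp: sat_Foralls[OF xs(1)] instance_at_def R')
    then obtain Z where Z: "Z \<in> concepts F (n + m)"
      "\<And>as. length as = n \<Longrightarrow> instance_at e \<phi> xs (m, j) as (sec Z as) F d"
      using ch[OF \<phi> e xs(1)] xs(2) by metis
    have "sat F d (e(R := Con Z)) (Foralls xs (subst1 \<phi> R' (Sec (Var R) (map Var xs))))"
      unfolding sat_Foralls[OF xs(1)] sat_subst1
    proof (intro allI impI)
      fix as :: "nat list" assume "length as = length xs"
      then have as: "length as = n" using xs(2) by simp
      let ?e = "upds (e(R := Con Z)) xs as"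
      have "den d ?e (Sec (Var R) (map Var xs)) = Con (sec Z as)"
        using map_the_num_upds[OF ov as, of "e(R := Con Z)"] Rxs by (simp add: upds_other comp_def)
      moreover have "sat F d (?e(R' := Con (sec Z as))) \<phi> =
          sat F d ((upds e xs as)(R' := Con (sec Z as))) \<phi>"
      proof (rule sat_cong)
        fix x assume "x \<in> fv \<phi>"
        then have "?e x = upds e xs as x" using R by (intro upds_cong) auto
        then show "(?e(R' := Con (sec Z as))) x = ((upds e xs as)(R' := Con (sec Z as))) x" by simp
      qed
      ultimately show "sat F d (?e(R' := den d ?e (Sec (Var R) (map Var xs)))) \<phi>"
        using Z(2)[OF as] by (simp add: instance_at_def R')
    qed
    then show ?thesis using Z(1) nm(3) by auto
  qed
  then show ?thesis unfolding \<psi> valid_def by simp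
qed

theorem theorem3p5:
  fixes k :: nat and m :: "nat \<Rightarrow> nat" and R S :: "nat \<Rightarrow> var" and E :: "nat \<Rightarrow> fm"
  assumes "k \<ge> 1"
    and "\<And>i. i < k \<Longrightarrow> m i \<ge> 1"
    and "\<And>i. i < k \<Longrightarrow> wff [] (E i)"
    and "\<And>i. i < k \<Longrightarrow> fst (R i) = Cn (m i) \<and> fst (S i) = Cn (m i) \<and> R i \<noteq> S i"
    and "\<And>i. i < k \<Longrightarrow> fv (E i) = {R i, S i}"
    and "\<And>i. i < k \<Longrightarrow> proves [] (SO \<union> GC []) (equivalence (m i) (R i) (S i) (E i))"
  shows "consistent (map m [0..<k]) (Sigma11_A (map m [0..<k]) R S E \<union> SO \<union> GC (map m [0..<k]))"
proof -
  let ?ms = "map m [0..<k]" and ?d0 = "\<lambda>_ _. 0 :: nat"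
  define eqv where "eqv i = relation_of (R i) (S i) (E i)" for i
  \<comment> \<open>Provability is used only through truth in the standard model; the constant code
    function is a dummy, no operator being present.\<close>
  have equiv: "valid UNIV ?d0 (equivalence (m i) (R i) (S i) (E i))" if "i < k" for i
    by (rule soundness[OF section_closed_UNIV valid_SO_GC_UNIV assms(6)[OF that]])
  interpret forcing ?ms eqv
  proof
    fix i assume "i < length ?ms"
    then have i: "i < k" by simp
    note rel = relation_of_equivalence[OF assms(5)[OF i] _ equiv[OF i]]
    fix X assume X: "X \<in> concepts UNIV (?ms ! i)"
    show "eqv i X X" unfolding eqv_def using rel(1) assms(4)[OF i] X i by simp
    fix Y assume Y: "Y \<in> concepts UNIV (?ms ! i)" "eqv i X Y"
    then show "eqv i Y X" using rel(2)[of X Y] assms(4)[OF i] X i by (simp add: eqv_def)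
    fix Z assume "Z \<in> concepts UNIV (?ms ! i)" "eqv i Y Z"
    then show "eqv i X Z" using rel(3)[of X Y Z] assms(4)[OF i] X Y i by (simp add: eqv_def)
  qed
  obtain F d where F: "section_closed F" "{} \<in> F"
    and codes: "\<And>i X Y. i < length ?ms \<Longrightarrow> X \<in> concepts F (?ms ! i) \<Longrightarrow> Y \<in> concepts F (?ms ! i) \<Longrightarrow>
      d i X = d i Y \<longleftrightarrow> eqv i X Y"
    and TV: "\<And>\<phi> x e v. assignment F e \<Longrightarrow> v \<in> range_of UNIV (fst x) \<Longrightarrow>
      sat UNIV ?d0 (e(x := v)) \<phi> \<Longrightarrow> \<exists>w\<in>range_of F (fst x). sat UNIV ?d0 (e(x := w)) \<phi>"
    and FOC: "\<And>\<phi> e xs. wff ?ms \<phi> \<Longrightarrow> first_order \<phi> \<Longrightarrow> assignment F e \<Longrightarrow> \<forall>x\<in>set xs. fst x = Ob \<Longrightarrow>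
      extension F d e xs \<phi> \<in> F"
    and CH: "\<And>\<phi> e xs m j. wff ?ms \<phi> \<Longrightarrow> sigma11 \<phi> \<Longrightarrow> assignment F e \<Longrightarrow> \<forall>x\<in>set xs. fst x = Ob \<Longrightarrow>
      \<forall>as. length as = length xs \<longrightarrow> (\<exists>X. instance_at e \<phi> xs (m, j) as X F d) \<Longrightarrow>
      \<exists>Z\<in>concepts F (length xs + m). \<forall>as. length as = length xs \<longrightarrow>
        instance_at e \<phi> xs (m, j) as (sec Z as) F d"
  proof (rule generic_model, goal_cases)
    case (1 F d)
    show ?thesis by (rule that[OF 1(2-7)])
  qed
  have elementary: "sat F d e \<phi> \<longleftrightarrow> sat UNIV ?d0 e \<phi>" if "wff [] \<phi>" "assignment F e" for \<phi> e
    by (rule sat_elementary[OF F(1) TV that])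
  have FOC_valid: "valid F d \<phi>" if "\<phi> \<in> comprehension {\<phi>. wff ?ms \<phi> \<and> first_order \<phi>}" for \<phi>
    using that unfolding comprehension_def valid_def
    by (auto intro!: sat_comprehension FOC simp only: obj_vars_def mem_Collect_eq)
  \<comment> \<open>Concept quantifiers are allowed in these formulas, so first-order absoluteness
    does not apply; the whole instance is free of operators and is inherited from the standard model
    by elementarity.\<close>
  have SO_comprehension: "valid F d \<phi>" if "\<phi> \<in> comprehension {\<phi>. wff [] \<phi>}" for \<phi>
  proof -
    have "valid UNIV ?d0 \<phi>" using that by (intro valid_SO_GC_UNIV) (simp add: SO_def)
    moreover have "wff [] \<phi>"
      using that by (auto simp: comprehension_def wff_Foralls obj_vars_def intro!: has_sort_Var)
    ultimately show ?thesis
      using elementary assignment_mono[of F UNIV] by (simp add: valid_def)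
  qed
  show ?thesis
  proof (rule consistent_if_valid[OF F])
    fix \<phi> assume "\<phi> \<in> Sigma11_A ?ms R S E \<union> SO \<union> GC ?ms"
    then consider i where "i < k" "\<phi> = abstraction i (R i) (S i) (E i)"
      | "\<phi> \<in> comprehension {\<phi>. wff ?ms \<phi> \<and> first_order \<phi>}"
      | "\<phi> \<in> choice {\<phi>. wff ?ms \<phi> \<and> sigma11 \<phi>}"
      | "\<phi> \<in> section_axioms" | "\<phi> \<in> extensionality" | "\<phi> \<in> comprehension {\<phi>. wff [] \<phi>}"
      | "\<phi> \<in> linear_order" | "\<phi> \<in> least_schema {\<phi>. wff ?ms \<phi>}"
      by (auto simp: Sigma11_A_def SO_def GC_def)
    then show "valid F d \<phi>"
    proof cases
      case 1
      show ?thesis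
        unfolding 1(2)
        by (rule valid_abstraction[where m = "m i"])
          (use codes[of i] elementary assms(3-5)[OF 1(1)] 1(1) in \<open>auto simp: eqv_def\<close>)
    next
      case 3
      show ?thesis by (rule valid_choice[OF CH 3]) auto
    qed (simp_all add: FOC_valid SO_comprehension valid_section_axioms valid_extensionality
        valid_linear_order valid_least_schema)
  qed
qed

end
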